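(* Let $T$ be any one of the three sets $\left(-\frac12,-\frac14\right)\cup\left(\frac14,\frac12\right)$, $\left(-\frac14,0\right)\cup\left(\frac14,\frac12\right)$, $\left(-\frac12,-\frac14\right)\cup\left(0,\frac14\right)$. Let $h$ be absolutely monotone with $h^{(8)}>0$ in $(-1,1)$, and let $C\subset\mathbb{S}^{15}$ be a $T$-avoiding spherical code with $|C|=4320$. Then $$E_h(C)\ \ge\ \mathcal{E}_h(16,4320;T)=4320\left(280\left(h\!\left(-\tfrac12\right)+h\!\left(\tfrac12\right)\right)+1024\left(h\!\left(-\tfrac14\right)+h\!\left(\tfrac14\right)\right)+1710\,h(0)+h(-1)\right).$$ Equality $E_h(C)=\mathcal{E}_h(16,4320;T)$ is attained when $C$ is a spherical $7$-design with $I(C)=\{-1,-\frac12,-\frac14,0,\frac14,\frac12\}$ (and hence a distance-invariant code) and with distance distribution $(1,280,1024,1710,1024,280)$. In particular, the kissing configuration $C_{BW}$ of the Barnes--Wall lattice is $T$-avoiding universally optimal on $\mathbb{S}^{15}$.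
   Context: A spherical code is a finite set $C\subset\mathbb{S}^{n-1}$; $I(C)=\{x\cdot y: x,y\in C,\ x\ne y\}$. For $T\subset[-1,1)$, $C$ is $T$-avoiding if $I(C)\cap T=\varnothing$. A spherical $\tau$-design is a spherical code $C$ such that the average over $C$ of every polynomial in $n$ variables of total degree at most $\tau$ equals its average over $\mathbb{S}^{n-1}$ with respect to normalized surface measure. A potential is a function $h:[-1,1)\to(-\infty,+\infty)$, continuous on $[-1,1)$; it is absolutely monotone if $h^{(j)}\ge0$ for all $j\ge1$ (on $(-1,1)$). The $h$-energy is $E_h(C)=\sum_{x\neq y\in C}h(x\cdot y)$ (sum over ordered pairs). $\mathcal{E}_h(n,N;T)$ is the minimum of $E_h(C)$ over all $T$-avoiding spherical codes $C\subset\mathbb{S}^{n-1}$ with $|C|=N$. For $T$ open, a code $C\subset\mathbb{S}^{n-1}$ is $T$-avoiding universally optimal if it is $T$-avoiding and, for every absolutely monotone $h$, it minimizes $E_h$ among all $T$-avoiding codes on $\mathbb{S}^{n-1}$ of cardinality $|C|$. A code $C$ is distance invariant if for each $t\in I(C)$ the number $A_t=|\{y\in C: x\cdot y=t\}|$ does not depend on $x\in C$; its distance distribution is the tuple $(A_t)$ listed in increasing order of $t\in I(C)$. $C_{BW}\subset\mathbb{S}^{15}$ is the kissing configuration of the Barnes--Wall lattice in $\mathbb{R}^{16}$, i.e. its $4320$ minimal vectors rescaled to unit length. It is an antipodal spherical $7$-design with the inner products and distance distribution listed in the claim. *)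

theory Defs
  imports "HOL-Analysis.Analysis"
begin

section \<open>Spherical codes\<close>

text \<open>Codes on the sphere of dimension $n-1$ are subsets of \<open>real^'n\<close> with \<open>CARD('n) = n\<close>.\<close>

definition spherical_code :: "(real^'n) set \<Rightarrow> bool" where
  "spherical_code C \<longleftrightarrow> finite C \<and> C \<subseteq> sphere 0 1"

definition inner_products :: "(real^'n) set \<Rightarrow> real set" where
  "inner_products C = {x \<bullet> y | x y. x \<in> C \<and> y \<in> C \<and> x \<noteq> y}"

definition avoiding :: "real set \<Rightarrow> (real^'n) set \<Rightarrow> bool" where
  "avoiding T C \<longleftrightarrow> inner_products C \<inter> T = {}"

definition distance_invariant :: "(real^'n) set \<Rightarrow> bool" where
  "distance_invariant C \<longleftrightarrow>
     (\<forall>t \<in> inner_products C. \<exists>a. \<forall>x \<in> C. card {y \<in> C. x \<bullet> y = t} = a)"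

text \<open>\<open>As\<close> lists the numbers $A_t$ by increasing $t$, seen from every point of \<open>C\<close>.\<close>

definition has_distance_distribution :: "(real^'n) set \<Rightarrow> nat list \<Rightarrow> bool" where
  "has_distance_distribution C As \<longleftrightarrow>
     (\<forall>x \<in> C. map (\<lambda>t. card {y \<in> C. x \<bullet> y = t}) (sorted_list_of_set (inner_products C)) = As)"


section \<open>Spherical designs\<close>

text \<open>
  Normalized surface measure: the measure of a Borel set \<open>A\<close> of unit vectors is the volume of the
  cone \<open>{r *\<^sub>R x | r x. 0 < r \<and> r < 1 \<and> x \<in> A}\<close> relative to that of the unit ball. It is given
  here as a Borel measure on the whole space, concentrated on the sphere.
\<close>

definition sphere_measure :: "(real^'n) measure" where
  "sphere_measure =
     distr (uniform_measure lborel (ball 0 1 - {0})) borel (\<lambda>x. x /\<^sub>R norm x)"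

text \<open>
  The index set of the sum is the set of exponent vectors of total degree at most \<open>d\<close>; it is
  finite because \<open>'n\<close> is.
\<close>

definition polynomial_of_degree_le :: "nat \<Rightarrow> (real^'n \<Rightarrow> real) \<Rightarrow> bool" where
  "polynomial_of_degree_le d p \<longleftrightarrow>
     (\<exists>c :: ('n \<Rightarrow> nat) \<Rightarrow> real.
        p = (\<lambda>x. \<Sum>\<alpha> \<in> {\<alpha>. (\<Sum>i\<in>UNIV. \<alpha> i) \<le> d}. c \<alpha> * (\<Prod>i\<in>UNIV. (x $ i) ^ \<alpha> i)))"

definition spherical_design :: "nat \<Rightarrow> (real^'n) set \<Rightarrow> bool" where
  "spherical_design d C \<longleftrightarrow> spherical_code C \<and>
     (\<forall>p. polynomial_of_degree_le d p \<longrightarrow>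
        (\<Sum>x\<in>C. p x) / real (card C) = (\<integral>x. p x \<partial>sphere_measure))"


section \<open>Potentials and energy\<close>

text \<open>
  A potential is a function on \<open>{-1..<1}\<close>; it is represented by a total function whose values
  elsewhere are irrelevant. On the open interval the iterated derivatives
  only depend on the values there.
\<close>

definition potential :: "(real \<Rightarrow> real) \<Rightarrow> bool" where
  "potential h \<longleftrightarrow> continuous_on {-1..<1} h"

definition absolutely_monotone :: "(real \<Rightarrow> real) \<Rightarrow> bool" where
  "absolutely_monotone h \<longleftrightarrow> potential h \<and>
     (\<forall>j. (deriv ^^ j) h differentiable_on {-1<..<1}) \<and>
     (\<forall>j \<ge> 1. \<forall>t \<in> {-1<..<1}. (deriv ^^ j) h t \<ge> 0)"

definition energy :: "(real \<Rightarrow> real) \<Rightarrow> (real^'n) set \<Rightarrow> real" where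
  "energy h C = (\<Sum>(x, y) \<in> {(x, y). x \<in> C \<and> y \<in> C \<and> x \<noteq> y}. h (x \<bullet> y))"

definition admissible_codes :: "nat \<Rightarrow> real set \<Rightarrow> (real^'n) set set" where
  "admissible_codes N T = {C. spherical_code C \<and> avoiding T C \<and> card C = N}"

text \<open>
  The minimum is a genuine one (\<open>Least\<close>, not an infimum), hence only meaningful when attained.
  The dimension is passed as a type.
\<close>

definition min_energy :: "'n::finite itself \<Rightarrow> (real \<Rightarrow> real) \<Rightarrow> nat \<Rightarrow> real set \<Rightarrow> real" where
  "min_energy _ h N T = (LEAST e. e \<in> energy h ` (admissible_codes N T :: (real^'n) set set))"

definition avoiding_universally_optimal :: "real set \<Rightarrow> (real^'n) set \<Rightarrow> bool" where
  "avoiding_universally_optimal T C \<longleftrightarrow> spherical_code C \<and> avoiding T C \<and>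
     (\<forall>h. absolutely_monotone h \<longrightarrow>
        (\<forall>D :: (real^'n) set. D \<in> admissible_codes (card C) T \<longrightarrow> energy h C \<le> energy h D))"


section \<open>The Barnes--Wall lattice\<close>

text \<open>
  The coordinates \<open>of_nat k\<close>, \<open>k < 16\<close>, enumerate the index type \<open>16\<close>; the binary digits of \<open>k\<close>
  identify it with a point of the affine 4-space over the field with two elements. The codewords of
  the first-order Reed--Muller code of length 16 (a $[16,5,8]$ code) are the affine functions on
  that space.
\<close>

definition mod2_in_reed_muller :: "int^16 \<Rightarrow> bool" where
  "mod2_in_reed_muller z \<longleftrightarrow>
     (\<exists>(b::int) (a::nat \<Rightarrow> int). \<forall>k<16.
        z $ of_nat k mod 2 = (b + (\<Sum>j<4. a j * int (k div 2 ^ j mod 2))) mod 2)"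

text \<open>
  Construction B applied to this code (Conway and Sloane, Sphere Packings, Lattices and Groups,
  Chapter 4), with the usual scaling, for which the minimal vectors have squared norm 4.
\<close>

definition barnes_wall_lattice :: "(real^16) set" where
  "barnes_wall_lattice =
     {\<chi> i. real_of_int (z $ i) / sqrt 2 | z :: int^16.
        mod2_in_reed_muller z \<and> 4 dvd (\<Sum>i\<in>UNIV. z $ i)}"

definition minimal_vectors :: "(real^'n) set \<Rightarrow> (real^'n) set" where
  "minimal_vectors L = {x \<in> L - {0}. \<forall>y \<in> L - {0}. norm x \<le> norm y}"

definition kissing_configuration :: "(real^'n) set \<Rightarrow> (real^'n) set" where
  "kissing_configuration L = (\<lambda>x. x /\<^sub>R norm x) ` minimal_vectors L"

end

theory Submission
  imports Defs "HOL-Computational_Algebra.Polynomial"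
begin

text \<open>
  Linear programming bound with prescribed gaps. The polynomial \<open>f\<close> that interpolates \<open>h\<close> at the six
  inner products of the Barnes--Wall code, and to first order at a suitable one of them, lies below
  \<open>h\<close> outside \<open>T\<close>. In Newton form its coefficients are divided differences of \<open>h\<close>, hence
  nonnegative, and each Newton basis polynomial has nonnegative Gegenbauer coefficients in dimension
  16. So the \<open>f\<close>-energy is bounded below by its spherical mean, and the Barnes--Wall code attains
  this bound, since it has no inner products outside the six nodes.

  Positive definiteness of the Gegenbauer kernels uses the Fischer inner product on polynomials, for
  which multiplication by a variable is adjoint to differentiation: zonal harmonics are orthogonal to
  multiples of \<open>\<parallel>y\<parallel>\<^sup>2\<close>, so their Gram matrix is the kernel up to a factor.
\<close>

section \<open>Positive definiteness of Gegenbauer polynomials\<close>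

text \<open>The doubled node \<open>d\<close> comes last in the Newton form, so its second
  occurrence does not enter the basis: the basis consists of the partial products of
  \<open>t - s\<close> over the six nodes in increasing order, the same for all three sets
  \<open>T\<close>, and one table of Gegenbauer expansions, \<open>bw_newton_gegen\<close>, serves
  them all. \<open>T\<close> only decides which node has to be doubled for the remainder to be
  nonnegative off \<open>T\<close>. The obstacle is the node -1, where \<open>h\<close> is
  continuous but need not be differentiable. Hence \<open>d > -1\<close>, and the first application
  of Rolle's theorem to \<open>h - p\<close> is kept apart from the later ones: it moves all zeros
  into the open interval. Sharpness is a finite computation. The mean of each Newton basis
  polynomial is compared with its weighted sum over the nodes, the weights being the distance
  distribution; and this distribution is found for the Barnes--Wall code by counting sign vectors
  supported on pairs and on words of weight 8. Spherical designs enter for distance invariance,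
  through rotation invariance of the surface measure.\<close>

definition expo_deg :: "('a::finite \<Rightarrow> nat) \<Rightarrow> nat" where
  "expo_deg \<alpha> = (\<Sum>i\<in>UNIV. \<alpha> i)"

lemma finite_expo_deg_le: "finite {\<alpha> :: 'a::finite \<Rightarrow> nat. (\<Sum>i\<in>UNIV. \<alpha> i) \<le> d}"
proof (rule finite_subset)
  show "{\<alpha>. (\<Sum>i\<in>UNIV. \<alpha> i) \<le> d} \<subseteq> PiE UNIV (\<lambda>_::'a. {..d})"
  proof (clarsimp simp: PiE_UNIV_domain)
    fix \<alpha> :: "'a \<Rightarrow> nat" and i
    assume "(\<Sum>i\<in>UNIV. \<alpha> i) \<le> d"
    then show "\<alpha> i \<le> d" using member_le_sum[of i UNIV \<alpha>] by simp
  qed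
  show "finite (PiE UNIV (\<lambda>_::'a. {..d}))" by (intro finite_PiE) auto
qed

lemma finite_expo_deg_eq [simp]: "finite {\<alpha> :: 'a::finite \<Rightarrow> nat. expo_deg \<alpha> = d}"
  by (rule finite_subset[OF _ finite_expo_deg_le[of d]]) (auto simp: expo_deg_def)

lemma expo_deg_upd: "expo_deg (\<alpha>(i := Suc (\<alpha> i))) = Suc (expo_deg \<alpha>)"
proof -
  have "expo_deg (\<alpha>(i := Suc (\<alpha> i))) = (\<Sum>j\<in>UNIV. \<alpha> j + (if j = i then 1 else 0))"
    unfolding expo_deg_def by (rule sum.cong) auto
  then show ?thesis by (simp add: expo_deg_def sum.distrib)
qed

text \<open>Polynomials are represented by arbitrary coefficient functions on exponent vectors,
  without a finiteness condition; \<open>fischer\<close> and \<open>peval\<close> look at a single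
  degree. \<open>pmul i\<close> is multiplication by the variable \<open>i\<close>,
  \<open>pder i\<close> the partial derivative, \<open>lap\<close> the Laplacian and
  \<open>rsq\<close> multiplication by the squared norm.\<close>

definition pmul :: "'a \<Rightarrow> (('a \<Rightarrow> nat) \<Rightarrow> real) \<Rightarrow> ('a \<Rightarrow> nat) \<Rightarrow> real" where
  "pmul i p \<alpha> = (if \<alpha> i = 0 then 0 else p (\<alpha>(i := \<alpha> i - 1)))"

definition pder :: "'a \<Rightarrow> (('a \<Rightarrow> nat) \<Rightarrow> real) \<Rightarrow> ('a \<Rightarrow> nat) \<Rightarrow> real" where
  "pder i p \<alpha> = real (Suc (\<alpha> i)) * p (\<alpha>(i := Suc (\<alpha> i)))"

definition lap :: "(('a::finite \<Rightarrow> nat) \<Rightarrow> real) \<Rightarrow> ('a \<Rightarrow> nat) \<Rightarrow> real" where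
  "lap p \<alpha> = (\<Sum>i\<in>UNIV. pder i (pder i p) \<alpha>)"

definition rsq :: "(('a::finite \<Rightarrow> nat) \<Rightarrow> real) \<Rightarrow> ('a \<Rightarrow> nat) \<Rightarrow> real" where
  "rsq p \<alpha> = (\<Sum>i\<in>UNIV. pmul i (pmul i p) \<alpha>)"

definition fischer ::
  "nat \<Rightarrow> (('a::finite \<Rightarrow> nat) \<Rightarrow> real) \<Rightarrow> (('a \<Rightarrow> nat) \<Rightarrow> real) \<Rightarrow> real" where
  "fischer k p q = (\<Sum>\<alpha> | expo_deg \<alpha> = k. (\<Prod>i\<in>UNIV. fact (\<alpha> i)) * p \<alpha> * q \<alpha>)"

definition homog :: "nat \<Rightarrow> (('a::finite \<Rightarrow> nat) \<Rightarrow> real) \<Rightarrow> bool" where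
  "homog k p \<longleftrightarrow> (\<forall>\<alpha>. expo_deg \<alpha> \<noteq> k \<longrightarrow> p \<alpha> = 0)"

definition peval :: "nat \<Rightarrow> real^'a \<Rightarrow> (('a::finite \<Rightarrow> nat) \<Rightarrow> real) \<Rightarrow> real" where
  "peval k x p = (\<Sum>\<alpha> | expo_deg \<alpha> = k. p \<alpha> * (\<Prod>i\<in>UNIV. (x $ i) ^ \<alpha> i))"

text \<open>The coefficients of the polynomial \<open>y \<mapsto> (x \<bullet> y) ^ m\<close>.\<close>

definition linpow :: "nat \<Rightarrow> real^'a \<Rightarrow> ('a::finite \<Rightarrow> nat) \<Rightarrow> real" where
  "linpow m x \<alpha> = (if expo_deg \<alpha> = m then fact m * (\<Prod>i\<in>UNIV. (x $ i) ^ \<alpha> i / fact (\<alpha> i)) else 0)"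

text \<open>Raising the exponent of \<open>i\<close> maps the vectors of degree \<open>k\<close>
  bijectively onto those of degree \<open>Suc k\<close> with a nonzero entry at \<open>i\<close>;
  the assumption discards the rest.\<close>

lemma sum_expo_deg_Suc:
  fixes f :: "('a::finite \<Rightarrow> nat) \<Rightarrow> real"
  assumes "\<And>\<alpha>. \<alpha> i = 0 \<Longrightarrow> f \<alpha> = 0"
  shows "(\<Sum>\<alpha> | expo_deg \<alpha> = Suc k. f \<alpha>) = (\<Sum>\<alpha> | expo_deg \<alpha> = k. f (\<alpha>(i := Suc (\<alpha> i))))"
proof -
  have "(\<Sum>\<alpha> | expo_deg \<alpha> = Suc k. f \<alpha>) = (\<Sum>\<alpha> | expo_deg \<alpha> = Suc k \<and> \<alpha> i \<noteq> 0. f \<alpha>)"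
    using assms by (intro sum.mono_neutral_right) auto
  also have "\<dots> = (\<Sum>\<alpha> | expo_deg \<alpha> = k. f (\<alpha>(i := Suc (\<alpha> i))))"
  proof (rule sum.reindex_bij_witness[of _ "\<lambda>\<alpha>. \<alpha>(i := Suc (\<alpha> i))" "\<lambda>\<alpha>. \<alpha>(i := \<alpha> i - 1)"])
    fix \<alpha> :: "'a \<Rightarrow> nat"
    assume a: "\<alpha> \<in> {\<alpha>. expo_deg \<alpha> = Suc k \<and> \<alpha> i \<noteq> 0}"
    let ?\<beta> = "\<alpha>(i := \<alpha> i - 1)"
    show eq: "?\<beta>(i := Suc (?\<beta> i)) = \<alpha>" using a by auto
    then have "Suc (expo_deg ?\<beta>) = Suc k" using a expo_deg_upd[of ?\<beta> i] by simp
    then show "?\<beta> \<in> {\<alpha>. expo_deg \<alpha> = k}" by simp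
    show "f (?\<beta>(i := Suc (?\<beta> i))) = f \<alpha>" by (simp only: eq)
  qed (auto simp: expo_deg_upd)
  finally show ?thesis .
qed

text \<open>Stated with \<open>if\<close> because this is the form that simplification gives to
  \<open>(\<alpha>(i := Suc (\<alpha> i))) j\<close>.\<close>

lemma prod_upd_Suc:
  fixes g :: "'a::finite \<Rightarrow> nat \<Rightarrow> real"
  assumes "g i (Suc (\<alpha> i)) = c * g i (\<alpha> i)"
  shows "(\<Prod>j\<in>UNIV. g j (if j = i then Suc (\<alpha> i) else \<alpha> j)) = c * (\<Prod>j\<in>UNIV. g j (\<alpha> j))"
proof -
  have "(\<Prod>j\<in>UNIV. g j (if j = i then Suc (\<alpha> i) else \<alpha> j)) =
      (\<Prod>j\<in>UNIV. (if j = i then c else 1) * g j (\<alpha> j))"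
    by (rule prod.cong) (auto simp: assms)
  then show ?thesis by (simp add: prod.distrib)
qed

text \<open>Raising the exponent of \<open>i\<close> multiplies the weight of a monomial by
  \<open>Suc (\<alpha> i)\<close>, exactly the factor that differentiation produces. This is what
  the factorial weights are for.\<close>

lemma fischer_pmul: "fischer (Suc k) (pmul i p) q = fischer k p (pder i q)"
  unfolding fischer_def
  by (subst sum_expo_deg_Suc[where i = i])
     (auto simp: pmul_def pder_def prod_upd_Suc[where g = "\<lambda>_. fact" and c = "real (Suc (_ i))"] intro!: sum.cong)

lemma fischer_sum_left: "fischer k (\<lambda>\<alpha>. \<Sum>i\<in>I. c i * p i \<alpha>) q = (\<Sum>i\<in>I. c i * fischer k (p i) q)"
  unfolding fischer_def sum_distrib_left sum_distrib_right
  by (subst sum.swap) (simp add: mult_ac)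

lemma fischer_commute: "fischer k p q = fischer k q p"
  unfolding fischer_def by (simp add: mult_ac)

lemma fischer_rsq: "fischer (Suc (Suc k)) (rsq p) q = fischer k p (lap q)"
proof -
  have "fischer (Suc (Suc k)) (rsq p) q = (\<Sum>i\<in>UNIV. fischer (Suc (Suc k)) (pmul i (pmul i p)) q)"
    using fischer_sum_left[where I = UNIV and c = "\<lambda>_. 1" and p = "\<lambda>i. pmul i (pmul i p)"]
    by (simp add: rsq_def[abs_def])
  also have "\<dots> = (\<Sum>i\<in>UNIV. fischer k (pder i (pder i q)) p)"
    by (simp add: fischer_pmul fischer_commute[of k p])
  also have "\<dots> = fischer k (lap q) p"
    using fischer_sum_left[where I = UNIV and c = "\<lambda>_. 1" and p = "\<lambda>i. pder i (pder i q)"]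
    by (simp add: lap_def[abs_def])
  finally show ?thesis by (simp add: fischer_commute)
qed

lemma fischer_self_nonneg: "fischer k p p \<ge> 0"
  unfolding fischer_def
  by (rule sum_nonneg) (simp add: mult.assoc prod_nonneg)

text \<open>Reproducing property: the factorial weights cancel the denominators of the multinomial
  coefficients in \<open>linpow\<close>.\<close>

lemma fischer_linpow: "fischer k (linpow k x) p = fact k * peval k x p"
  unfolding fischer_def peval_def sum_distrib_left
  by (rule sum.cong) (auto simp: linpow_def prod_dividef)

lemma pder_linpow: "pder i (linpow m x) \<alpha> = real m * x $ i * linpow (m - 1) x \<alpha>"
proof (cases "expo_deg \<alpha> = m - 1 \<and> m > 0")
  case True
  then obtain k where m: "m = Suc k" "expo_deg \<alpha> = k" by (cases m) auto
  have "(\<Prod>j\<in>UNIV. x $ j ^ (if j = i then Suc (\<alpha> i) else \<alpha> j) / fact (if j = i then Suc (\<alpha> i) else \<alpha> j)) =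
      x $ i / Suc (\<alpha> i) * (\<Prod>j\<in>UNIV. x $ j ^ \<alpha> j / fact (\<alpha> j))"
    by (rule prod_upd_Suc[where g = "\<lambda>j n. x $ j ^ n / fact n"]) simp
  then show ?thesis using m
    by (simp add: pder_def linpow_def expo_deg_upd del: of_nat_Suc)
next
  case False
  then show ?thesis by (auto simp: pder_def linpow_def expo_deg_upd)
qed

lemma pder_cmult: "pder i (\<lambda>\<alpha>. c * p \<alpha>) \<alpha> = c * pder i p \<alpha>"
  by (simp add: pder_def)

lemma pder_sum: "pder i (\<lambda>\<alpha>. \<Sum>j\<in>J. p j \<alpha>) \<alpha> = (\<Sum>j\<in>J. pder i (p j) \<alpha>)"
  by (simp add: pder_def sum_distrib_left)

lemma pmul_sum: "pmul i (\<lambda>\<alpha>. \<Sum>j\<in>J. p j \<alpha>) \<alpha> = (\<Sum>j\<in>J. pmul i (p j) \<alpha>)"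
  by (simp add: pmul_def)

lemma lap_sum: "lap (\<lambda>\<alpha>. \<Sum>j\<in>J. c j * p j \<alpha>) \<alpha> = (\<Sum>j\<in>J. c j * lap (p j) \<alpha>)"
  unfolding lap_def
  by (subst sum_distrib_left, subst sum.swap) (simp add: pder_sum[abs_def] pder_cmult[abs_def])

lemma rsq_cmult: "rsq (\<lambda>\<alpha>. c * p \<alpha>) \<alpha> = c * rsq p \<alpha>"
  by (auto simp: rsq_def pmul_def sum_distrib_left intro!: sum.cong)

lemma rsq_add: "rsq (\<lambda>\<alpha>. p \<alpha> + q \<alpha>) \<alpha> = rsq p \<alpha> + rsq q \<alpha>"
  by (auto simp: rsq_def pmul_def sum.distrib[symmetric] intro!: sum.cong)

lemma lap_linpow:
  "lap (linpow m x) \<alpha> = real m * (real m - 1) * (x \<bullet> x) * linpow (m - 2) x \<alpha>"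
proof -
  have "lap (linpow m x) \<alpha> = (\<Sum>i\<in>UNIV. real m * real (m - 1) * (x $ i * x $ i) * linpow (m - 2) x \<alpha>)"
    by (simp add: lap_def pder_linpow[abs_def] pder_cmult pder_linpow numeral_2_eq_2 mult_ac)
  also have "\<dots> = real m * real (m - 1) * (x \<bullet> x) * linpow (m - 2) x \<alpha>"
    by (simp add: inner_vec_def sum_distrib_left sum_distrib_right)
  \<comment> \<open>\<open>real (m - 1)\<close> and \<open>real m - 1\<close> differ only for
    \<open>m = 0\<close>, where the factor \<open>real m\<close> vanishes.\<close>
  finally show ?thesis by (cases m) auto
qed

lemma homog_rsq: "homog k p \<Longrightarrow> homog (Suc (Suc k)) (rsq p)"
  unfolding homog_def rsq_def pmul_def
proof (intro allI impI sum.neutral ballI)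
  fix \<alpha> :: "'a \<Rightarrow> nat" and i
  assume p: "\<forall>\<alpha>. expo_deg \<alpha> \<noteq> k \<longrightarrow> p \<alpha> = 0" and a: "expo_deg \<alpha> \<noteq> Suc (Suc k)"
  show "(if \<alpha> i = 0 then 0 else if (\<alpha>(i := \<alpha> i - 1)) i = 0 then 0
      else p (\<alpha>(i := \<alpha> i - 1, i := (\<alpha>(i := \<alpha> i - 1)) i - 1))) = 0"
  proof (cases "\<alpha> i \<ge> 2")
    case True
    let ?\<beta> = "\<alpha>(i := \<alpha> i - 2)"
    have "?\<beta>(i := Suc (?\<beta> i)) = \<alpha>(i := \<alpha> i - 1)" using True by (simp add: Suc_diff_le[symmetric])
    then have 1: "expo_deg (\<alpha>(i := \<alpha> i - 1)) = Suc (expo_deg ?\<beta>)" using expo_deg_upd[of ?\<beta> i] by simp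
    have "(\<alpha>(i := \<alpha> i - 1))(i := Suc ((\<alpha>(i := \<alpha> i - 1)) i)) = \<alpha>" using True by auto
    then have "expo_deg \<alpha> = Suc (expo_deg (\<alpha>(i := \<alpha> i - 1)))"
      using expo_deg_upd[of "\<alpha>(i := \<alpha> i - 1)" i] by simp
    then have "expo_deg ?\<beta> \<noteq> k" using 1 a by simp
    then show ?thesis using p by (simp add: numeral_2_eq_2)
  qed auto
qed

lemma homog_rsq_pow: "homog k p \<Longrightarrow> homog (k + 2 * j) ((rsq ^^ j) p)"
  by (induction j) (auto dest: homog_rsq)

lemma homog_linpow: "homog m (linpow m x)"
  by (simp add: homog_def linpow_def)

text \<open>The commutator of the Laplacian with multiplication by the squared norm. Operators in
  different variables commute; in the same variable the commutator multiplies the coefficient at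
  \<open>\<alpha>\<close> by \<open>4 * \<alpha> i + 2\<close>, and summing over \<open>i\<close>
  turns this into the dimension and the degree.\<close>

lemma lap_rsq:
  fixes p :: "('a::finite \<Rightarrow> nat) \<Rightarrow> real"
  assumes "homog d p"
  shows "lap (rsq p) \<alpha> = rsq (lap p) \<alpha> + (2 * real CARD('a) + 4 * real d) * p \<alpha>"
proof -
  have comm: "pder i (pder i (pmul j (pmul j p))) \<alpha> =
      pmul j (pmul j (pder i (pder i p))) \<alpha> + (if i = j then (4 * real (\<alpha> i) + 2) * p \<alpha> else 0)" for i j
  proof (cases "i = j")
    case True
    then show ?thesis
      by (cases "\<alpha> i"; cases "\<alpha> i - 1") (auto simp: pder_def pmul_def algebra_simps fun_upd_idem)
  next
    case False
    then show ?thesis by (simp add: pder_def pmul_def fun_upd_twist)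
  qed
  have "lap (rsq p) \<alpha> = (\<Sum>i\<in>UNIV. \<Sum>j\<in>UNIV. pder i (pder i (pmul j (pmul j p))) \<alpha>)"
    by (simp add: lap_def rsq_def[abs_def] pder_sum[abs_def])
  also have "\<dots> = (\<Sum>i\<in>UNIV. \<Sum>j\<in>UNIV. pmul j (pmul j (pder i (pder i p))) \<alpha>)
      + (\<Sum>i\<in>UNIV. (4 * real (\<alpha> i) + 2) * p \<alpha>)"
    by (simp add: comm sum.distrib)
  also have "(\<Sum>i\<in>UNIV. \<Sum>j\<in>UNIV. pmul j (pmul j (pder i (pder i p))) \<alpha>) = rsq (lap p) \<alpha>"
    by (subst sum.swap) (simp add: lap_def[abs_def] rsq_def pmul_sum[abs_def])
  also have "(\<Sum>i\<in>UNIV. (4 * real (\<alpha> i) + 2) * p \<alpha>) = (4 * real (expo_deg \<alpha>) + 2 * CARD('a)) * p \<alpha>"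
    by (simp add: expo_deg_def sum_distrib_right[symmetric] sum.distrib sum_distrib_left[symmetric])
  also have "\<dots> = (2 * real CARD('a) + 4 * real d) * p \<alpha>"
    using assms by (cases "expo_deg \<alpha> = d") (auto simp: homog_def)
  finally show ?thesis .
qed

text \<open>Iterating \<open>lap_rsq\<close>: after \<open>i\<close> factors the degree is
  \<open>d + 2 * i\<close>, and the constants \<open>2 * n + 4 * (d + 2 * i)\<close> for
  \<open>i < j\<close>, with \<open>n\<close> the dimension, add up to the one stated.\<close>

lemma lap_rsq_pow:
  fixes p :: "('a::finite \<Rightarrow> nat) \<Rightarrow> real"
  assumes "homog d p"
  shows "lap ((rsq ^^ j) p) \<alpha> = (rsq ^^ j) (lap p) \<alpha>
    + 2 * real j * (2 * real j - 2 + real CARD('a) + 2 * real d) * (rsq ^^ (j - 1)) p \<alpha>"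
proof (induction j arbitrary: \<alpha>)
  case (Suc j)
  let ?n = "real CARD('a)"
  have "lap ((rsq ^^ Suc j) p) \<alpha> = rsq (lap ((rsq ^^ j) p)) \<alpha>
      + (2 * ?n + 4 * real (d + 2 * j)) * (rsq ^^ j) p \<alpha>"
    using lap_rsq[OF homog_rsq_pow[OF assms]] by simp
  also have "rsq (lap ((rsq ^^ j) p)) \<alpha> = (rsq ^^ Suc j) (lap p) \<alpha>
    + 2 * real j * (2 * real j - 2 + ?n + 2 * real d) * rsq ((rsq ^^ (j - 1)) p) \<alpha>"
    by (simp add: Suc.IH[abs_def] rsq_add rsq_cmult)
  also have "2 * real j * (2 * real j - 2 + ?n + 2 * real d) * rsq ((rsq ^^ (j - 1)) p) \<alpha>
    = 2 * real j * (2 * real j - 2 + ?n + 2 * real d) * (rsq ^^ j) p \<alpha>" by (cases j) auto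
  finally show ?case by (simp add: algebra_simps)
qed simp

section \<open>Evaluation of coefficient functions at a point\<close>

lemma peval_sum: "peval k x (\<lambda>\<alpha>. \<Sum>i\<in>I. c i * p i \<alpha>) = (\<Sum>i\<in>I. c i * peval k x (p i))"
  unfolding peval_def sum_distrib_left sum_distrib_right
  by (subst sum.swap) (simp add: mult_ac)

lemma peval_pmul: "peval (Suc k) x (pmul i p) = x $ i * peval k x p"
  unfolding peval_def sum_distrib_left
  by (subst sum_expo_deg_Suc[where i = i])
     (auto simp: pmul_def prod_upd_Suc[where g = "\<lambda>j n. x $ j ^ n" and c = "x $ i"] mult_ac intro!: sum.cong)

lemma peval_rsq: "peval (Suc (Suc k)) x (rsq p) = (x \<bullet> x) * peval k x p"
  using peval_sum[where I = UNIV and c = "\<lambda>_. 1" and p = "\<lambda>i. pmul i (pmul i p)"]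
  unfolding rsq_def[abs_def] by (simp add: peval_pmul inner_vec_def sum_distrib_left mult_ac)

lemma peval_rsq_pow: "peval (k + 2 * j) x ((rsq ^^ j) p) = (x \<bullet> x) ^ j * peval k x p"
  by (induction j) (auto simp: peval_rsq)

text \<open>Replaces the multinomial theorem by Euler's identity: up to the factor
  \<open>Suc m\<close>, each summand is the variable \<open>i\<close> times the partial derivative
  of \<open>linpow (Suc m) x\<close>, which multiplies the coefficient at \<open>\<alpha>\<close> by
  \<open>\<alpha> i\<close>.\<close>

lemma linpow_Suc: "linpow (Suc m) x \<alpha> = (\<Sum>i\<in>UNIV. x $ i * pmul i (linpow m x) \<alpha>)"
proof -
  have *: "real (Suc m) * (x $ i * pmul i (linpow m x) \<alpha>) = real (\<alpha> i) * linpow (Suc m) x \<alpha>" for i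
  proof -
    have "real (Suc m) * (x $ i * pmul i (linpow m x) \<alpha>) = pmul i (pder i (linpow (Suc m) x)) \<alpha>"
      by (simp add: pmul_def pder_linpow)
    also have "\<dots> = real (\<alpha> i) * linpow (Suc m) x \<alpha>"
      by (simp add: pmul_def pder_def)
    finally show ?thesis .
  qed
  have "real (Suc m) * (\<Sum>i\<in>UNIV. x $ i * pmul i (linpow m x) \<alpha>) = (\<Sum>i\<in>UNIV. real (\<alpha> i)) * linpow (Suc m) x \<alpha>"
    unfolding sum_distrib_left sum_distrib_right by (rule sum.cong) (auto simp only: *)
  also have "\<dots> = real (Suc m) * linpow (Suc m) x \<alpha>"
    by (auto simp: expo_deg_def linpow_def of_nat_sum[symmetric] simp del: of_nat_sum of_nat_Suc)
  finally show ?thesis by simp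
qed

lemma peval_linpow: "peval m x (linpow m y) = (x \<bullet> y) ^ m"
proof (induction m)
  case 0
  have "{\<alpha>. expo_deg \<alpha> = 0} = {\<lambda>_::'a. 0}" by (auto simp: expo_deg_def)
  then show ?case by (simp add: peval_def linpow_def expo_deg_def)
next
  case (Suc m)
  then show ?case
    by (simp add: linpow_Suc[abs_def] peval_sum peval_pmul inner_vec_def sum_distrib_right mult_ac)
qed

text \<open>
  The coefficients that make \<open>y \<mapsto> \<Sum>j. gegen_coeff n k j * (y \<bullet> y) ^ j * (x \<bullet> y) ^ (k - 2 * j)\<close>
  harmonic for a unit vector \<open>x\<close> in dimension \<open>n\<close>.
\<close>

fun gegen_coeff :: "nat \<Rightarrow> nat \<Rightarrow> nat \<Rightarrow> real" where
  "gegen_coeff n k 0 = 1"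
| "gegen_coeff n k (Suc j) = - gegen_coeff n k j * (real k - 2 * real j) * (real k - 2 * real j - 1)
     / (2 * real (Suc j) * (2 * real j + real n + 2 * (real k - 2 * real j - 2)))"

text \<open>Gegenbauer polynomials with leading coefficient 1.\<close>

definition gegen :: "nat \<Rightarrow> nat \<Rightarrow> real \<Rightarrow> real" where
  "gegen n k t = (\<Sum>j\<le>k div 2. gegen_coeff n k j * t ^ (k - 2 * j))"

definition zonal :: "nat \<Rightarrow> real^'a \<Rightarrow> ('a::finite \<Rightarrow> nat) \<Rightarrow> real" where
  "zonal k x \<alpha> = (\<Sum>j\<le>k div 2. gegen_coeff CARD('a) k j * (rsq ^^ j) (linpow (k - 2 * j) x) \<alpha>)"

lemma rsq_pow_cmult: "(rsq ^^ j) (\<lambda>\<alpha>. c * p \<alpha>) = (\<lambda>\<alpha>. c * (rsq ^^ j) p \<alpha>)"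
proof (induction j)
  case (Suc j)
  have "(rsq ^^ Suc j) (\<lambda>\<alpha>. c * p \<alpha>) = rsq (\<lambda>\<alpha>. c * (rsq ^^ j) p \<alpha>)"
    by (simp only: funpow.simps o_apply Suc.IH)
  also have "\<dots> = (\<lambda>\<alpha>. c * (rsq ^^ Suc j) p \<alpha>)"
    by (rule ext) (simp only: rsq_cmult funpow.simps o_apply)
  finally show ?case .
qed simp

lemma lap_zonal:
  fixes x :: "real^'a"
  assumes "norm x = 1"
  shows "lap (zonal k x) \<alpha> = 0"
proof -
  let ?n = "real CARD('a)"
  define c where "c = gegen_coeff CARD('a) k"
  \<comment> \<open>\<open>t j\<close> is what the Laplacian of the linear power contributes in
    summand \<open>j\<close>. The recursion of \<open>gegen_coeff\<close> is chosen so that the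
    commutator part of summand \<open>Suc j\<close> is \<open>- t j\<close>, and the sum
    telescopes.\<close>
  define t where "t j = c j * (real k - 2 * real j) * (real k - 2 * real j - 1)
      * (rsq ^^ j) (linpow (k - 2 * Suc j) x) \<alpha>" for j
  have xx: "x \<bullet> x = 1" using assms by (simp add: dot_square_norm)
  have lap_term: "c j * lap ((rsq ^^ j) (linpow (k - 2 * j) x)) \<alpha> = t j - (if j = 0 then 0 else t (j - 1))"
    if "j \<le> k div 2" for j
  proof -
    have kj: "real (k - 2 * j) = real k - 2 * real j" using that by simp
    have 1: "lap (linpow (k - 2 * j) x) =
        (\<lambda>\<alpha>. (real k - 2 * real j) * (real k - 2 * real j - 1) * linpow (k - 2 * Suc j) x \<alpha>)"
      by (rule ext) (simp add: lap_linpow xx kj del: of_nat_diff; simp add: mult_ac)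
    have 2: "c j * (2 * real j * (2 * real j - 2 + ?n + 2 * real (k - 2 * j)) * (rsq ^^ (j - 1)) (linpow (k - 2 * j) x) \<alpha>)
        = - (if j = 0 then 0 else t (j - 1))"
    proof (cases j)
      case (Suc i)
      have nz: "2 * real i + ?n + 2 * (real k - 2 * real i - 2) > 0"
      proof -
        have "real k \<ge> 2 * real j" using that by linarith
        then have "real k - 2 * real i - 2 \<ge> 0" using Suc by simp
        moreover have "?n > 0" by simp
        ultimately show ?thesis by (smt (verit) of_nat_0_le_iff)
      qed
      have cj: "c j * (2 * real (Suc i) * (2 * real i + ?n + 2 * (real k - 2 * real i - 2))) =
          - (c i * (real k - 2 * real i) * (real k - 2 * real i - 1))"
        using nz by (simp add: c_def Suc del: of_nat_Suc)
      have e: "2 * real j - 2 + ?n + 2 * real (k - 2 * j) = 2 * real i + ?n + 2 * (real k - 2 * real i - 2)"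
        unfolding kj by (simp add: Suc)
      have "c j * (2 * real j * (2 * real j - 2 + ?n + 2 * real (k - 2 * j)) * (rsq ^^ (j - 1)) (linpow (k - 2 * j) x) \<alpha>)
        = (c j * (2 * real (Suc i) * (2 * real i + ?n + 2 * (real k - 2 * real i - 2)))) * (rsq ^^ i) (linpow (k - 2 * Suc i) x) \<alpha>"
        unfolding e by (simp add: Suc)
      also have "\<dots> = - t i" unfolding cj t_def by simp
      finally show ?thesis using Suc by simp
    qed simp
    show ?thesis
      unfolding lap_rsq_pow[OF homog_linpow] distrib_left[of "c j"] 2 1 rsq_pow_cmult
      unfolding t_def by simp
  qed
  have tel: "(\<Sum>j\<le>m. t j - (if j = 0 then 0 else t (j - 1))) = t m" for m
    by (induction m) auto
  \<comment> \<open>At \<open>j = k div 2\<close> one of the factors \<open>k - 2 * j\<close> and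
    \<open>k - 2 * j - 1\<close> is zero, according to the parity of \<open>k\<close>.\<close>
  have last: "t (k div 2) = 0"
  proof -
    have "k = 2 * (k div 2) \<or> k = 2 * (k div 2) + 1" by presburger
    then have "real k = 2 * real (k div 2) \<or> real k = 2 * real (k div 2) + 1"
      by (metis of_nat_1 of_nat_add of_nat_mult of_nat_numeral)
    then show ?thesis by (auto simp: t_def)
  qed
  have "lap (zonal k x) \<alpha> = (\<Sum>j\<le>k div 2. c j * lap ((rsq ^^ j) (linpow (k - 2 * j) x)) \<alpha>)"
    unfolding zonal_def[abs_def] lap_sum c_def ..
  also have "\<dots> = (\<Sum>j\<le>k div 2. t j - (if j = 0 then 0 else t (j - 1)))"
    by (rule sum.cong) (auto simp: lap_term)
  finally show ?thesis by (simp add: tel last)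
qed

lemma peval_zonal:
  fixes x y :: "real^'a"
  assumes "norm x = 1"
  shows "peval k x (zonal k y) = gegen CARD('a) k (x \<bullet> y)"
proof -
  have xx: "x \<bullet> x = 1" using assms by (simp add: dot_square_norm)
  have "peval k x ((rsq ^^ j) (linpow (k - 2 * j) y)) = (x \<bullet> y) ^ (k - 2 * j)" if "j \<le> k div 2" for j
    using peval_rsq_pow[of "k - 2 * j" j x "linpow (k - 2 * j) y"] that by (simp add: xx peval_linpow)
  then show ?thesis by (simp add: zonal_def[abs_def] peval_sum gegen_def)
qed

text \<open>All summands of \<open>zonal k x\<close> with \<open>j > 0\<close> pair to zero with the
  harmonic \<open>zonal k y\<close>; pairing with the remaining \<open>linpow k x\<close> is
  evaluation at \<open>x\<close>.\<close>

lemma fischer_zonal: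
  fixes x y :: "real^'a"
  assumes "norm x = 1" "norm y = 1"
  shows "fischer k (zonal k x) (zonal k y) = fact k * gegen CARD('a) k (x \<bullet> y)"
proof -
  let ?c = "gegen_coeff CARD('a) k"
  have "fischer k ((rsq ^^ j) (linpow (k - 2 * j) x)) (zonal k y) = 0" if jk: "j \<le> k div 2" and j0: "j \<noteq> 0" for j
  proof -
    obtain i where j: "j = Suc i" using j0 by (cases j) auto
    have "k \<ge> 2" using jk j by linarith
    then obtain m where k: "k = Suc (Suc m)" by (metis Suc_le_D numeral_2_eq_2 Suc_le_mono)
    have "lap (zonal k y) = (\<lambda>_. 0)" using lap_zonal[OF assms(2)] by auto
    then show ?thesis
      using fischer_rsq[of m "(rsq ^^ i) (linpow (k - 2 * j) x)" "zonal k y"]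
      by (simp add: j k fischer_def)
  qed
  then have "fischer k (zonal k x) (zonal k y) =
      (\<Sum>j\<le>k div 2. if j = 0 then ?c 0 * fischer k (linpow k x) (zonal k y) else 0)"
    unfolding zonal_def[of k x, abs_def] fischer_sum_left by (intro sum.cong) auto
  then show ?thesis by (simp add: fischer_linpow peval_zonal assms)
qed

theorem gegen_positive_definite:
  fixes C :: "(real^'a) set"
  assumes "C \<subseteq> sphere 0 1"
  shows "(\<Sum>x\<in>C. \<Sum>y\<in>C. gegen CARD('a) k (x \<bullet> y)) \<ge> 0"
proof -
  define F where "F = (\<lambda>\<alpha>. \<Sum>x\<in>C. 1 * zonal k x \<alpha>)"
  have "fischer k F F = (\<Sum>x\<in>C. \<Sum>y\<in>C. fischer k (zonal k x) (zonal k y))"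
    unfolding F_def fischer_sum_left
    by (subst fischer_commute, subst fischer_sum_left) (simp add: fischer_commute)
  also have "\<dots> = fact k * (\<Sum>x\<in>C. \<Sum>y\<in>C. gegen CARD('a) k (x \<bullet> y))"
    unfolding sum_distrib_left
    by (intro sum.cong refl fischer_zonal) (use assms in auto)
  finally have "0 \<le> fact k * (\<Sum>x\<in>C. \<Sum>y\<in>C. gegen CARD('a) k (x \<bullet> y))"
    using fischer_self_nonneg[of k F] by simp
  then show ?thesis by (rule mult_left_le_imp_le[of "fact k :: real" 0, simplified])
qed

section \<open>Hermite interpolation of absolutely monotone functions\<close>

text \<open>At the left end only continuity is demanded, as is available for \<open>h\<close> at -1.
  The new zeros lie strictly between consecutive old ones; their disjointness from \<open>S\<close>
  later allows a double zero to be counted once more. The bound \<open>s < Max S\<close> keeps the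
  zero from the last gap apart from the earlier ones in the induction.\<close>

lemma rolle_zeros:
  fixes g g' :: "real \<Rightarrow> real"
  assumes cont: "continuous_on {a..<b} g"
    and der: "\<And>x. x \<in> {a<..<b} \<Longrightarrow> (g has_real_derivative g' x) (at x)"
    and "finite S" "S \<noteq> {}" "S \<subseteq> {a..<b}" "\<forall>s\<in>S. g s = 0"
  shows "\<exists>S'. finite S' \<and> Suc (card S') = card S \<and> S' \<subseteq> {a<..<b} \<and> S \<inter> S' = {}
    \<and> (\<forall>s\<in>S'. s < Max S \<and> g' s = 0)"
  using assms(3-)
proof (induction rule: finite_linorder_max_induct)
  case (insert u S)
  show ?case
  proof (cases "S = {}")
    case True
    then show ?thesis by (intro exI[of _ "{}"]) auto
  next
    case False
    then obtain S' where S': "finite S'" "Suc (card S') = card S" "S' \<subseteq> {a<..<b}" "S \<inter> S' = {}"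
      "\<forall>s\<in>S'. s < Max S \<and> g' s = 0"
      using insert by auto
    let ?v = "Max S"
    have v: "?v \<in> S" "?v < u" using insert False by auto
    have sub: "{?v..u} \<subseteq> {a..<b}" using insert.prems v by auto
    have "\<exists>z. ?v < z \<and> z < u \<and> g' z = 0"
    proof -
      have "\<exists>z. ?v < z \<and> z < u \<and> (g has_real_derivative 0) (at z)"
      proof (rule Rolle)
        show "g ?v = g u" using insert.prems v by auto
        show "continuous_on {?v..u} g" using continuous_on_subset[OF cont sub] .
        fix x assume "?v < x" "x < u"
        then have "x \<in> {a<..<b}" using insert.prems v by auto
        then show "g differentiable (at x)" using der real_differentiable_def by blast
      qed fact
      then obtain z where z: "?v < z" "z < u" "(g has_real_derivative 0) (at z)" by blast
      then have "z \<in> {a<..<b}" using insert.prems v by auto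
      then show ?thesis using z der DERIV_unique by blast
    qed
    then obtain z where z: "?v < z" "z < u" "g' z = 0" by blast
    have zS: "z \<notin> S'" "z \<notin> S" using S' z insert.hyps(1) by (auto simp: not_less dest: Max_ge)
    have m: "Max (insert u S) = u" using insert.hyps v False by (auto intro!: Max_eqI dest: less_imp_le)
    show ?thesis
    proof (intro exI[of _ "insert z S'"] conjI)
      show "Suc (card (insert z S')) = card (insert u S)" using S' zS insert.hyps by auto
      show "insert z S' \<subseteq> {a<..<b}" using S' z v insert.prems by auto
      show "insert u S \<inter> insert z S' = {}" using S' zS z v by fastforce
      show "\<forall>s\<in>insert z S'. s < Max (insert u S) \<and> g' s = 0" unfolding m using S' z v by force
    qed (use S' in auto)
  qed
qed simp

lemma rolle_higher:
  fixes G :: "nat \<Rightarrow> real \<Rightarrow> real"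
  assumes der: "\<And>j x. x \<in> {a<..<b} \<Longrightarrow> (G j has_real_derivative G (Suc j) x) (at x)"
    and "finite S" "card S = Suc m" "S \<subseteq> {a<..<b}" "\<forall>s\<in>S. G j s = 0"
  shows "\<exists>x\<in>{a<..<b}. G (j + m) x = 0"
  using assms(2-)
proof (induction m arbitrary: S j)
  case 0
  then show ?case by (auto simp: card_Suc_eq)
next
  case (Suc m)
  \<comment> \<open>The functions \<open>G j\<close> need not be continuous at \<open>a\<close>, so
    the half-open interval starts at the least zero instead.\<close>
  obtain a' where a': "a < a'" "S \<subseteq> {a'..<b}"
  proof (rule that[of "Min S"])
    have "Min S \<in> S" using Suc.prems by (intro Min_in) auto
    then show "a < Min S" using Suc.prems by auto
    show "S \<subseteq> {Min S..<b}" using Suc.prems by auto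
  qed
  have "continuous_on {a'..<b} (G j)"
  proof (intro continuous_at_imp_continuous_on ballI)
    fix x assume "x \<in> {a'..<b}"
    then have "x \<in> {a<..<b}" using a' by auto
    then show "isCont (G j) x" using der DERIV_isCont by blast
  qed
  moreover have "(G j has_real_derivative G (Suc j) x) (at x)" if "x \<in> {a'<..<b}" for x
    using der that a' by auto
  ultimately obtain S' where "finite S'" "Suc (card S') = card S" "S' \<subseteq> {a'<..<b}" "\<forall>s\<in>S'. G (Suc j) s = 0"
    using rolle_zeros[of a' b "G j" "G (Suc j)" S] Suc.prems a' by (metis card.empty nat.distinct(1))
  then show ?case using Suc.IH[of S' "Suc j"] Suc.prems a' by force
qed

lemma higher_pderiv_degree:
  fixes p :: "real poly"
  assumes "degree p \<le> m"
  shows "(pderiv ^^ m) p = [:fact m * coeff p m:]"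
proof (rule poly_eqI)
  fix n
  show "coeff ((pderiv ^^ m) p) n = coeff [:fact m * coeff p m:] n"
    using assms by (cases n) (auto simp: coeff_higher_pderiv pochhammer_fact[symmetric] coeff_eq_0)
qed

section \<open>Newton polynomials for a list of nodes\<close>

definition node_poly :: "real list \<Rightarrow> real poly" where
  "node_poly ts = prod_list (map (\<lambda>s. [:-s, 1:]) ts)"

lemma poly_node_poly: "poly (node_poly ts) t = prod_list (map (\<lambda>s. t - s) ts)"
  by (induction ts) (auto simp: node_poly_def algebra_simps)

lemma degree_node_poly: "degree (node_poly ts) = length ts" "coeff (node_poly ts) (length ts) = 1"
proof -
  have "degree (node_poly ts) = length ts \<and> lead_coeff (node_poly ts) = 1"
  proof (induction ts)
    case (Cons s ts)
    then have "node_poly ts \<noteq> 0" by auto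
    then have "degree (node_poly (s # ts)) = Suc (degree (node_poly ts))"
      by (simp add: node_poly_def degree_mult_eq del: mult_pCons_left)
    moreover have "lead_coeff (node_poly (s # ts)) = lead_coeff (node_poly ts)"
      by (simp add: node_poly_def lead_coeff_mult del: mult_pCons_left)
    ultimately show ?case using Cons by (metis length_Cons)
  qed (simp add: node_poly_def)
  then show "degree (node_poly ts) = length ts" "coeff (node_poly ts) (length ts) = 1" by auto
qed

lemma poly_node_poly_eq_0_iff: "poly (node_poly ts) t = 0 \<longleftrightarrow> t \<in> set ts"
  by (auto simp: poly_node_poly prod_list_zero_iff)

lemma pderiv_node_poly_nonzero:
  assumes "distinct ts" "d \<in> set ts"
  shows "poly (pderiv (node_poly ts)) d \<noteq> 0"
  using assms
proof (induction ts)
  case (Cons s ts)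
  have "node_poly (s # ts) = [:-s, 1:] * node_poly ts" by (simp add: node_poly_def)
  then have "poly (pderiv (node_poly (s # ts))) d =
      (d - s) * poly (pderiv (node_poly ts)) d + poly (node_poly ts) d"
    by (simp add: pderiv_mult pderiv_pCons del: mult_pCons_left)
  moreover have "poly (node_poly ts) d = 0 \<longleftrightarrow> d \<in> set ts" by (rule poly_node_poly_eq_0_iff)
  ultimately show ?case using Cons by (cases "d = s") auto
qed simp

definition newton_poly :: "(nat \<Rightarrow> real) \<Rightarrow> real list \<Rightarrow> nat \<Rightarrow> real poly" where
  "newton_poly c ts n = (\<Sum>k<n. smult (c k) (node_poly (take k ts)))"

lemma degree_newton_poly_less: "k \<ge> n \<Longrightarrow> n \<le> length ts \<Longrightarrow> coeff (newton_poly c ts n) k = 0"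
  unfolding newton_poly_def coeff_sum coeff_smult
  by (intro sum.neutral ballI) (auto intro!: coeff_eq_0 simp: degree_node_poly)

section \<open>Signs of the Newton coefficients of an absolutely monotone function\<close>

context
  fixes h :: "real \<Rightarrow> real"
  assumes am: "absolutely_monotone h"
begin

lemma am_continuous: "continuous_on {-1..<1} h"
  using am by (auto simp: absolutely_monotone_def potential_def)

lemma am_deriv:
  assumes "x \<in> {-1<..<1}"
  shows "((deriv ^^ j) h has_real_derivative (deriv ^^ Suc j) h x) (at x)"
proof -
  have "(deriv ^^ j) h differentiable at x"
    using am assms by (auto simp: absolutely_monotone_def differentiable_on_eq_differentiable_at)
  then show ?thesis by (simp add: DERIV_deriv_iff_real_differentiable)
qed

lemma am_diff_deriv:
  assumes "x \<in> {-1<..<1}"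
  shows "((\<lambda>x. (deriv ^^ j) h x - poly ((pderiv ^^ j) p) x) has_real_derivative
    (deriv ^^ Suc j) h x - poly ((pderiv ^^ Suc j) p) x) (at x)"
  by (intro DERIV_diff am_deriv assms) (simp add: poly_DERIV)

text \<open>The \<open>m\<close>-th derivative of \<open>p\<close> is the constant
  \<open>fact m * coeff p m\<close>, so a zero of the \<open>m\<close>-th derivative of
  \<open>h - p\<close> makes it a value of a derivative of \<open>h\<close>.\<close>

lemma top_coeff_nonneg:
  assumes "x \<in> {-1<..<1}" "(deriv ^^ m) h x - poly ((pderiv ^^ m) p) x = 0" "degree p \<le> m" "m \<ge> 1"
  shows "coeff p m \<ge> 0"
proof -
  have "fact m * coeff p m = (deriv ^^ m) h x" using assms(2) by (simp add: higher_pderiv_degree[OF assms(3)])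
  moreover have "(deriv ^^ m) h x \<ge> 0" using am assms(1,4) unfolding absolutely_monotone_def by blast
  ultimately have "0 \<le> fact m * coeff p m" by simp
  then show ?thesis by (rule mult_left_le_imp_le[of "fact m :: real" 0, simplified])
qed

lemma am_rolle:
  assumes "finite S" "S \<noteq> {}" "S \<subseteq> {-1..<1}" "\<forall>s\<in>S. h s = poly p s"
  obtains S' where "finite S'" "Suc (card S') = card S" "S' \<subseteq> {-1<..<1}" "S \<inter> S' = {}"
    "\<forall>s\<in>S'. deriv h s - poly (pderiv p) s = 0"
proof -
  have "continuous_on {-1..<1} (\<lambda>x. h x - poly p x)" by (intro continuous_intros am_continuous)
  then have "\<exists>S'. finite S' \<and> Suc (card S') = card S \<and> S' \<subseteq> {-1<..<1} \<and> S \<inter> S' = {}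
    \<and> (\<forall>s\<in>S'. s < Max S \<and> deriv h s - poly (pderiv p) s = 0)"
    by (rule rolle_zeros) (use am_diff_deriv[of _ 0 p] assms in \<open>simp_all del: atLeastLessThan_iff\<close>)
  then show ?thesis using that by blast
qed

text \<open>The top coefficient is a divided difference of \<open>h\<close>. The
  \<open>Suc m\<close> zeros of \<open>h - p\<close> give \<open>m\<close> zeros of its derivative,
  now in the open interval, and repeated use of Rolle's theorem a zero of its \<open>m\<close>-th
  derivative.\<close>

lemma interpolation_coeff_nonneg:
  assumes "finite S" "card S = Suc m" "S \<subseteq> {-1..<1}" "\<forall>s\<in>S. h s = poly p s" "degree p \<le> m" "m \<ge> 1"
  shows "coeff p m \<ge> 0"
proof -
  obtain S' where S': "finite S'" "Suc (card S') = card S" "S' \<subseteq> {-1<..<1}"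
    "\<forall>s\<in>S'. deriv h s - poly (pderiv p) s = 0"
    using am_rolle[of S p] assms by (metis card.empty nat.distinct(1))
  obtain k where m: "m = Suc k" using assms by (cases m) auto
  have "\<exists>x\<in>{-1<..<1}. (deriv ^^ (1 + k)) h x - poly ((pderiv ^^ (1 + k)) p) x = 0"
    by (rule rolle_higher[where G = "\<lambda>j x. (deriv ^^ j) h x - poly ((pderiv ^^ j) p) x" and S = S'])
       (use S' assms m am_diff_deriv in auto)
  then show ?thesis using top_coeff_nonneg[of _ m p] assms m by auto
qed

text \<open>Divided difference with the node \<open>d\<close> doubled: \<open>m\<close> zeros give
  only \<open>m - 1\<close> zeros of the derivative between them, but \<open>d\<close> is a further
  one, distinct from these because it belongs to \<open>S\<close>.\<close>

lemma hermite_coeff_nonneg: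
  assumes "finite S" "card S = m" "S \<subseteq> {-1..<1}" "\<forall>s\<in>S. h s = poly p s" "degree p \<le> m"
    and d: "d \<in> S" "d > -1" "deriv h d = poly (pderiv p) d"
  shows "coeff p m \<ge> 0"
proof -
  obtain S' where S': "finite S'" "Suc (card S') = card S" "S' \<subseteq> {-1<..<1}" "S \<inter> S' = {}"
    "\<forall>s\<in>S'. deriv h s - poly (pderiv p) s = 0"
    using am_rolle[of S p] assms by blast
  obtain k where m: "m = Suc k" using assms S' by (cases m) auto
  have "\<exists>x\<in>{-1<..<1}. (deriv ^^ (1 + k)) h x - poly ((pderiv ^^ (1 + k)) p) x = 0"
  proof (rule rolle_higher[where G = "\<lambda>j x. (deriv ^^ j) h x - poly ((pderiv ^^ j) p) x" and S = "insert d S'"])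
    show "card (insert d S') = Suc k" using S' assms m by (subst card_insert_disjoint) auto
  qed (use S' assms m am_diff_deriv in auto)
  then show ?thesis using top_coeff_nonneg[of _ m p] assms m by auto
qed

text \<open>Appending a node adds one multiple of the nodal polynomial of the earlier ones, and its
  coefficient is the top coefficient of the new interpolant. Index 0 is excluded since that
  coefficient is a value of \<open>h\<close>, which may be negative.\<close>

lemma newton_interpolation:
  assumes "distinct ts" "set ts \<subseteq> {-1..<1}"
  shows "\<exists>c. (\<forall>k. 1 \<le> k \<and> k < length ts \<longrightarrow> c k \<ge> 0) \<and>
    (\<forall>t\<in>set ts. h t = poly (newton_poly c ts (length ts)) t)"
  using assms
proof (induction ts rule: rev_induct)
  case (snoc u ts)
  let ?n = "length ts"
  from snoc obtain c where c: "\<forall>k. 1 \<le> k \<and> k < ?n \<longrightarrow> c k \<ge> 0"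
    "\<forall>t\<in>set ts. h t = poly (newton_poly c ts ?n) t" by auto
  define c' where "c' = c(?n := (h u - poly (newton_poly c ts ?n) u) / poly (node_poly ts) u)"
  have eq: "newton_poly c' (ts @ [u]) (length (ts @ [u])) = newton_poly c ts ?n + smult (c' ?n) (node_poly ts)"
    by (simp add: newton_poly_def c'_def)
  have nz: "poly (node_poly ts) u \<noteq> 0" using snoc.prems by (simp add: poly_node_poly_eq_0_iff)
  have int: "\<forall>t\<in>set (ts @ [u]). h t = poly (newton_poly c' (ts @ [u]) (length (ts @ [u]))) t"
    unfolding eq using c nz by (auto simp: c'_def poly_node_poly_eq_0_iff[THEN iffD2])
  have "c' ?n \<ge> 0" if "?n \<ge> 1"
  proof -
    have "coeff (newton_poly c' (ts @ [u]) (length (ts @ [u]))) ?n \<ge> 0"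
    proof (rule interpolation_coeff_nonneg[OF _ _ _ int])
      show "card (set (ts @ [u])) = Suc ?n" using snoc.prems distinct_card[of "ts @ [u]"] by simp
      show "degree (newton_poly c' (ts @ [u]) (length (ts @ [u]))) \<le> ?n"
        by (rule degree_le) (auto intro!: degree_newton_poly_less)
    qed (use snoc.prems that in auto)
    then show ?thesis unfolding eq by (simp add: degree_newton_poly_less degree_node_poly)
  qed
  then have "\<forall>k. 1 \<le> k \<and> k < length (ts @ [u]) \<longrightarrow> c' k \<ge> 0"
    using c by (auto simp: c'_def less_Suc_eq)
  then show ?case using int by blast
qed simp

text \<open>The error of the interpolant at \<open>t\<close> is the nodal polynomial times
  \<open>t - d\<close>, times the divided difference of \<open>h\<close> at \<open>t\<close>, the
  nodes and \<open>d\<close> once more. The divided difference is nonnegative, so the sign of the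
  error is that of the nodal factor.\<close>

theorem newton_hermite_lower_bound:
  assumes ts: "distinct ts" "set ts \<subseteq> {-1..<1}" and d: "d \<in> set ts" "d > -1"
  obtains c where "\<And>k. 1 \<le> k \<Longrightarrow> k \<le> length ts \<Longrightarrow> c k \<ge> 0"
    and "\<And>t. t \<in> set ts \<Longrightarrow> h t = (\<Sum>k\<le>length ts. c k * prod_list (map (\<lambda>s. t - s) (take k ts)))"
    and "\<And>t. t \<in> {-1..<1} \<Longrightarrow> prod_list (map (\<lambda>s. t - s) ts) * (t - d) \<ge> 0 \<Longrightarrow>
      (\<Sum>k\<le>length ts. c k * prod_list (map (\<lambda>s. t - s) (take k ts))) \<le> h t"
proof -
  let ?n = "length ts" and ?w = "node_poly ts"
  from newton_interpolation[OF ts] obtain c0 where c0: "\<forall>k. 1 \<le> k \<and> k < ?n \<longrightarrow> c0 k \<ge> 0"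
    "\<forall>t\<in>set ts. h t = poly (newton_poly c0 ts ?n) t" by blast
  \<comment> \<open>The last coefficient adjusts the derivative at \<open>d\<close>: the nodal
    polynomial vanishes at all nodes, so the values stay, and \<open>d\<close> is a simple root of
    it.\<close>
  define c where "c = c0(?n := (deriv h d - poly (pderiv (newton_poly c0 ts ?n)) d) / poly (pderiv ?w) d)"
  define p where "p = newton_poly c0 ts ?n + smult (c ?n) ?w"
  have card: "card (set ts) = ?n" using ts distinct_card by blast
  have eq: "poly p t = (\<Sum>k\<le>?n. c k * prod_list (map (\<lambda>s. t - s) (take k ts)))" for t
  proof -
    have "(\<Sum>k<?n. c0 k * poly (node_poly (take k ts)) t) = (\<Sum>k<?n. c k * poly (node_poly (take k ts)) t)"
      by (rule sum.cong) (auto simp: c_def)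
    then show ?thesis
      by (simp add: p_def newton_poly_def poly_sum poly_node_poly lessThan_Suc_atMost[symmetric])
  qed
  have int: "\<forall>t\<in>set ts. h t = poly p t"
    using c0 by (auto simp: p_def poly_node_poly_eq_0_iff[THEN iffD2])
  have der: "deriv h d = poly (pderiv p) d"
    using pderiv_node_poly_nonzero[OF ts(1) d(1)] by (simp add: p_def pderiv_add pderiv_smult c_def)
  have high: "coeff p k = 0" if "k > ?n" for k
    using that by (simp add: p_def degree_newton_poly_less coeff_eq_0 degree_node_poly)
  have "coeff p ?n \<ge> 0"
    using hermite_coeff_nonneg[OF _ card ts(2) int _ d der] high by (simp add: degree_le)
  then have cn: "c ?n \<ge> 0" by (simp add: p_def degree_newton_poly_less degree_node_poly)
  have bound: "poly p t \<le> h t" if t: "t \<in> {-1..<1}" and pos: "poly ?w t * (t - d) \<ge> 0" for t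
  proof (cases "t \<in> set ts")
    case True
    then show ?thesis using int by simp
  next
    case False
    \<comment> \<open>\<open>K\<close> makes \<open>q\<close> agree with \<open>h\<close> at
      \<open>t\<close> too. As \<open>w'\<close> vanishes at the nodes and doubly at
      \<open>d\<close>, the earlier conditions survive, and \<open>K\<close> is the top coefficient
      of an interpolant with one more node.\<close>
    define K where "K = (h t - poly p t) / (poly ?w t * (t - d))"
    define w' where "w' = node_poly (d # ts)"
    define q where "q = p + smult K w'"
    have w': "w' = [:-d, 1:] * ?w" by (simp add: w'_def node_poly_def)
    have nz: "poly ?w t * (t - d) \<noteq> 0" using False d by (auto simp: poly_node_poly_eq_0_iff)
    have "coeff q (Suc ?n) \<ge> 0"
    proof (rule hermite_coeff_nonneg[where S = "insert t (set ts)" and d = d])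
      show "card (insert t (set ts)) = Suc ?n" using False card by simp
      show "\<forall>s\<in>insert t (set ts). h s = poly q s"
        using int nz by (auto simp: q_def w' K_def poly_node_poly_eq_0_iff[THEN iffD2] field_simps simp del: mult_pCons_left)
      show "degree q \<le> Suc ?n"
        by (rule degree_le) (auto simp: q_def high w'_def intro!: coeff_eq_0 disjI2 simp: degree_node_poly)
      have "poly (pderiv w') d = 0"
        using d unfolding w' pderiv_mult by (simp add: poly_node_poly_eq_0_iff)
      then show "deriv h d = poly (pderiv q) d" by (simp add: q_def pderiv_add pderiv_smult der)
    qed (use ts d t in auto)
    moreover have "coeff q (Suc ?n) = K"
      using degree_node_poly(2)[of "d # ts"] by (simp add: q_def high w'_def)
    ultimately have "K * (poly ?w t * (t - d)) \<ge> 0" using pos by simp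
    moreover have "h t - poly p t = K * (poly ?w t * (t - d))" using nz by (simp add: K_def)
    ultimately show ?thesis by simp
  qed
  show thesis
  proof (rule that[of c])
    show "c k \<ge> 0" if "1 \<le> k" "k \<le> ?n" for k using that cn c0 by (cases "k = ?n") (auto simp: c_def)
    show "h t = (\<Sum>k\<le>?n. c k * prod_list (map (\<lambda>s. t - s) (take k ts)))" if "t \<in> set ts" for t
      using int that eq by simp
    show "(\<Sum>k\<le>?n. c k * prod_list (map (\<lambda>s. t - s) (take k ts))) \<le> h t"
      if "t \<in> {-1..<1}" "prod_list (map (\<lambda>s. t - s) ts) * (t - d) \<ge> 0" for t
      using bound[OF that(1)] that(2) by (simp add: poly_node_poly eq)
  qed
qed

end

section \<open>The linear programming bound\<close>

lemma energy_eq_sum: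
  assumes "finite C"
  shows "energy h C = (\<Sum>x\<in>C. \<Sum>y\<in>C - {x}. h (x \<bullet> y))"
proof -
  have "{(x, y). x \<in> C \<and> y \<in> C \<and> x \<noteq> y} = (SIGMA x:C. C - {x})" by auto
  then show ?thesis using assms by (simp add: energy_def sum.Sigma)
qed

lemma inner_unit_bounds:
  fixes x y :: "'a::real_inner"
  assumes "norm x = 1" "norm y = 1" "x \<noteq> y"
  shows "x \<bullet> y \<in> {-1..<1}"
proof -
  have "0 < norm (x - y) ^ 2" using assms by simp
  also have "norm (x - y) ^ 2 = 2 - 2 * (x \<bullet> y)"
    using assms by (simp add: power2_norm_eq_inner norm_eq_1 inner_diff inner_commute)
  finally have "x \<bullet> y < 1" by simp
  then show ?thesis using Cauchy_Schwarz_ineq2[of x y] assms by auto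
qed

lemma gegen_0: "gegen n 0 t = 1"
  by (simp add: gegen_def)

lemma gegen_16:
  "gegen 16 (Suc 0) t = t"
  "gegen 16 2 t = t^2 - 1/16"
  "gegen 16 3 t = t^3 - t/6"
  "gegen 16 4 t = t^4 - 3/10 * t^2 + 1/120"
  "gegen 16 5 t = t^5 - 5/11 * t^3 + 3/88 * t"
  "gegen 16 6 t = t^6 - 5/8 * t^4 + 15/176 * t^2 - 1/704"
proof -
  have c: "gegen_coeff n k (Suc 0) = - real k * (real k - 1) / (2 * (real n + 2 * (real k - 2)))"
    "gegen_coeff n k 2 = - gegen_coeff n k (Suc 0) * (real k - 2) * (real k - 3) / (4 * (2 + real n + 2 * (real k - 4)))"
    "gegen_coeff n k 3 = - gegen_coeff n k 2 * (real k - 4) * (real k - 5) / (6 * (4 + real n + 2 * (real k - 6)))"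
    for n k by (simp_all add: eval_nat_numeral algebra_simps)
  have atMost: "{..Suc 0} = {0, Suc 0}" "{..2::nat} = {0, Suc 0, 2}" "{..3::nat} = {0, Suc 0, 2, 3}" by auto
  show
    "gegen 16 (Suc 0) t = t"
    "gegen 16 2 t = t^2 - 1/16"
    "gegen 16 3 t = t^3 - t/6"
    "gegen 16 4 t = t^4 - 3/10 * t^2 + 1/120"
    "gegen 16 5 t = t^5 - 5/11 * t^3 + 3/88 * t"
    "gegen 16 6 t = t^6 - 5/8 * t^4 + 15/176 * t^2 - 1/704"
    by (simp_all add: gegen_def atMost c)
qed

text \<open>Delsarte's inequality: positive definiteness allows dropping all terms but
  \<open>j = 0\<close>, whose kernel is constantly 1. The sign of \<open>g 0\<close> is
  free.\<close>

lemma gegen_combination_lower_bound: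
  fixes C :: "(real^'a) set"
  assumes "C \<subseteq> sphere 0 1" "\<And>j. 1 \<le> j \<Longrightarrow> j \<le> d \<Longrightarrow> g j \<ge> 0"
  shows "(\<Sum>x\<in>C. \<Sum>y\<in>C. \<Sum>j\<le>d. g j * gegen CARD('a) j (x \<bullet> y)) \<ge> g 0 * real (card C) ^ 2"
proof -
  have "(\<Sum>x\<in>C. \<Sum>y\<in>C. \<Sum>j\<le>d. g j * gegen CARD('a) j (x \<bullet> y)) =
      (\<Sum>j\<le>d. g j * (\<Sum>x\<in>C. \<Sum>y\<in>C. gegen CARD('a) j (x \<bullet> y)))"
    unfolding sum_distrib_left by (subst (2) sum.swap, subst sum.swap) simp
  also have "\<dots> \<ge> (\<Sum>j\<le>d. if j = 0 then g 0 * real (card C) ^ 2 else 0)"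
  proof (rule sum_mono)
    fix j assume "j \<in> {..d}"
    then show "(if j = 0 then g 0 * real (card C) ^ 2 else 0) \<le>
        g j * (\<Sum>x\<in>C. \<Sum>y\<in>C. gegen CARD('a) j (x \<bullet> y))"
      using gegen_positive_definite[OF assms(1), of j] assms(2)[of j]
      by (auto simp: gegen_0 power2_eq_square)
  qed
  finally show ?thesis by simp
qed

section \<open>The six nodes, their Newton basis and its Gegenbauer expansions\<close>

definition bw_nodes :: "real list" where
  "bw_nodes = [-1, -1/2, -1/4, 0, 1/4, 1/2]"

definition bw_newton :: "nat \<Rightarrow> real \<Rightarrow> real" where
  "bw_newton k t = prod_list (map (\<lambda>s. t - s) (take k bw_nodes))"

text \<open>The weights are the distance distribution of the Barnes--Wall code, so for a potential
  this is the energy per point.\<close>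

definition bw_dist_sum :: "(real \<Rightarrow> real) \<Rightarrow> real" where
  "bw_dist_sum f = 280 * (f (-1/2) + f (1/2)) + 1024 * (f (-1/4) + f (1/4)) + 1710 * f 0 + f (-1)"

text \<open>Row \<open>k\<close> expands \<open>bw_newton k\<close> in monic Gegenbauer polynomials
  for dimension 16. Its entry 0 is the mean over the sphere of \<open>bw_newton k\<close> applied to
  the inner product with a fixed unit vector.\<close>

definition bw_newton_gegen :: "nat \<Rightarrow> real list" where
  "bw_newton_gegen k =
    [[1], [1, 1], [9/16, 3/2, 1], [15/64, 25/24, 7/4, 1], [25/384, 5/12, 47/40, 7/4, 1],
     [5/512, 1/12, 57/160, 157/176, 3/2, 1], [1/3072, 1/192, 17/704, 25/176, 5/16, 1, 1]] ! k"

text \<open>The third claim is the design identity seen from one point of the code, with the point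
  itself as the value at 1. Checked by arithmetic for each row, it makes the bound sharp.\<close>

lemma bw_newton_eq_gegen:
  assumes "k \<le> 6"
  shows "bw_newton k t = (\<Sum>j\<le>k. bw_newton_gegen k ! j * gegen 16 j t)"
    and "\<And>j. j \<le> k \<Longrightarrow> bw_newton_gegen k ! j \<ge> 0"
    and "4320 * bw_newton_gegen k ! 0 = bw_newton k 1 + bw_dist_sum (bw_newton k)"
proof -
  have k: "k = 0 \<or> k = 1 \<or> k = 2 \<or> k = 3 \<or> k = 4 \<or> k = 5 \<or> k = 6" using assms by linarith
  have atMost: "{..2::nat} = {0, 1, 2}" "{..3::nat} = {0, 1, 2, 3}" "{..4::nat} = {0, 1, 2, 3, 4}"
    "{..5::nat} = {0, 1, 2, 3, 4, 5}" "{..6::nat} = {0, 1, 2, 3, 4, 5, 6}" by auto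
  show "bw_newton k t = (\<Sum>j\<le>k. bw_newton_gegen k ! j * gegen 16 j t)"
    using k by (elim disjE)
      (simp_all add: atMost bw_newton_def bw_nodes_def bw_newton_gegen_def gegen_16 gegen_0,
       simp_all add: field_simps eval_nat_numeral)
  show "bw_newton_gegen k ! j \<ge> 0" if "j \<le> k" for j
  proof -
    have "j = 0 \<or> j = 1 \<or> j = 2 \<or> j = 3 \<or> j = 4 \<or> j = 5 \<or> j = 6" using assms that by linarith
    then show ?thesis using k that by (elim disjE) (simp_all add: bw_newton_gegen_def)
  qed
  show "4320 * bw_newton_gegen k ! 0 = bw_newton k 1 + bw_dist_sum (bw_newton k)"
    using k by (elim disjE) (simp_all add: bw_newton_def bw_nodes_def bw_newton_gegen_def bw_dist_sum_def)
qed

lemma bw_newton_pair_sum_lower_bound: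
  fixes C :: "(real^16) set"
  assumes "C \<subseteq> sphere 0 1" "card C = 4320" "k \<le> 6"
  shows "(\<Sum>x\<in>C. \<Sum>y\<in>C. bw_newton k (x \<bullet> y)) \<ge> 4320 * (bw_newton k 1 + bw_dist_sum (bw_newton k))"
proof -
  have "bw_newton_gegen k ! 0 * real (card C) ^ 2 \<le> (\<Sum>x\<in>C. \<Sum>y\<in>C. bw_newton k (x \<bullet> y))"
    using gegen_combination_lower_bound[OF assms(1), of k "\<lambda>j. bw_newton_gegen k ! j"] bw_newton_eq_gegen[OF assms(3)]
    by simp
  then show ?thesis using bw_newton_eq_gegen(3)[OF assms(3)] assms(2) by (simp add: power2_eq_square)
qed

definition bw_avoided_sets :: "real set set" where
  "bw_avoided_sets = {{-1/2<..<-1/4} \<union> {1/4<..<1/2}, {-1/4<..<0} \<union> {1/4<..<1/2}, {-1/2<..<-1/4} \<union> {0<..<1/4}}"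

text \<open>
  Doubling the node \<open>d\<close> makes the nodal polynomial vanish to even order except at the end points
  of the two intervals of \<open>T\<close>.
\<close>

lemma bw_double_node:
  assumes "T \<in> bw_avoided_sets"
  obtains d where "d \<in> set bw_nodes" "d > -1"
    "\<And>t. t \<in> {-1..<1} \<Longrightarrow> t \<notin> T \<Longrightarrow> prod_list (map (\<lambda>s. t - s) bw_nodes) * (t - d) \<ge> 0"
proof -
  have gap: "(t - a) * (t - b) \<ge> 0" if "t \<notin> {a<..<b}" "a < b" for t a b :: real
    using that by (auto simp: zero_le_mult_iff)
  have prod: "prod_list (map (\<lambda>s. t - s) bw_nodes) =
      (t + 1) * (t - (-1/2)) * (t - (-1/4)) * (t - 0) * (t - 1/4) * (t - 1/2)" for t
    by (simp add: bw_nodes_def mult.assoc)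
  consider (1) "T = {-1/2<..<-1/4} \<union> {1/4<..<1/2}" | (2) "T = {-1/4<..<0} \<union> {1/4<..<1/2}"
    | (3) "T = {-1/2<..<-1/4} \<union> {0<..<1/4}"
    using assms by (auto simp: bw_avoided_sets_def)
  then show thesis
  proof cases
    case 1
    show thesis
    proof (rule that[of 0])
      fix t assume t: "t \<in> {-1..<1}" "t \<notin> T"
      have "0 \<le> t + 1" "0 \<le> (t - (-1/2)) * (t - (-1/4))" "0 \<le> (t - 1/4) * (t - 1/2)"
        using t 1 gap[of t "-1/2" "-1/4"] gap[of t "1/4" "1/2"] by auto
      then have "0 \<le> (t + 1) * ((t - (-1/2)) * (t - (-1/4))) * ((t - 1/4) * (t - 1/2)) * (t - 0)^2"
        by (rule mult_nonneg_nonneg[OF mult_nonneg_nonneg[OF mult_nonneg_nonneg] zero_le_power2])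
      also have "\<dots> = prod_list (map (\<lambda>s. t - s) bw_nodes) * (t - 0)"
        unfolding prod power2_eq_square by (simp only: mult_ac)
      finally show "prod_list (map (\<lambda>s. t - s) bw_nodes) * (t - 0) \<ge> 0" .
    qed (auto simp: bw_nodes_def)
  next
    case 2
    show thesis
    proof (rule that[of "-1/2"])
      fix t assume t: "t \<in> {-1..<1}" "t \<notin> T"
      have "0 \<le> t + 1" "0 \<le> (t - (-1/4)) * (t - 0)" "0 \<le> (t - 1/4) * (t - 1/2)"
        using t 2 gap[of t "-1/4" "0"] gap[of t "1/4" "1/2"] by auto
      then have "0 \<le> (t + 1) * ((t - (-1/4)) * (t - 0)) * ((t - 1/4) * (t - 1/2)) * (t - (-1/2))^2"
        by (rule mult_nonneg_nonneg[OF mult_nonneg_nonneg[OF mult_nonneg_nonneg] zero_le_power2])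
      also have "\<dots> = prod_list (map (\<lambda>s. t - s) bw_nodes) * (t - (-1/2))"
        unfolding prod power2_eq_square by (simp only: mult_ac)
      finally show "prod_list (map (\<lambda>s. t - s) bw_nodes) * (t - (-1/2)) \<ge> 0" .
    qed (auto simp: bw_nodes_def)
  next
    case 3
    show thesis
    proof (rule that[of "1/2"])
      fix t assume t: "t \<in> {-1..<1}" "t \<notin> T"
      have "0 \<le> t + 1" "0 \<le> (t - (-1/2)) * (t - (-1/4))" "0 \<le> (t - 0) * (t - 1/4)"
        using t 3 gap[of t "-1/2" "-1/4"] gap[of t "0" "1/4"] by auto
      then have "0 \<le> (t + 1) * ((t - (-1/2)) * (t - (-1/4))) * ((t - 0) * (t - 1/4)) * (t - 1/2)^2"
        by (rule mult_nonneg_nonneg[OF mult_nonneg_nonneg[OF mult_nonneg_nonneg] zero_le_power2])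
      also have "\<dots> = prod_list (map (\<lambda>s. t - s) bw_nodes) * (t - 1/2)"
        unfolding prod power2_eq_square by (simp only: mult_ac)
      finally show "prod_list (map (\<lambda>s. t - s) bw_nodes) * (t - 1/2) \<ge> 0" .
    qed (auto simp: bw_nodes_def)
  qed
qed

lemma bw_dist_sum_combination:
  "bw_dist_sum (\<lambda>t. \<Sum>k\<in>K. c k * f k t) = (\<Sum>k\<in>K. c k * bw_dist_sum (f k))"
  unfolding bw_dist_sum_def
  by (simp add: sum_distrib_left sum.distrib distrib_left mult.left_commute)

theorem energy_lower_bound:
  fixes C :: "(real^16) set"
  assumes T: "T \<in> bw_avoided_sets" and am: "absolutely_monotone h" and C: "C \<in> admissible_codes 4320 T"
  shows "energy h C \<ge> 4320 * bw_dist_sum h"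
proof -
  from bw_double_node[OF T] obtain d where d: "d \<in> set bw_nodes" "d > -1"
    "\<And>t. t \<in> {-1..<1} \<Longrightarrow> t \<notin> T \<Longrightarrow> prod_list (map (\<lambda>s. t - s) bw_nodes) * (t - d) \<ge> 0" by blast
  have len: "length bw_nodes = 6" by (simp add: bw_nodes_def)
  have "distinct bw_nodes" "set bw_nodes \<subseteq> {-1..<1}" by (auto simp: bw_nodes_def)
  from newton_hermite_lower_bound[OF am this d(1,2)] obtain c where
    c: "\<And>k. 1 \<le> k \<Longrightarrow> k \<le> 6 \<Longrightarrow> c k \<ge> 0"
      "\<And>t. t \<in> set bw_nodes \<Longrightarrow> h t = (\<Sum>k\<le>6. c k * bw_newton k t)"
    and le: "\<And>t. t \<in> {-1..<1} \<Longrightarrow> prod_list (map (\<lambda>s. t - s) bw_nodes) * (t - d) \<ge> 0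
      \<Longrightarrow> (\<Sum>k\<le>6. c k * bw_newton k t) \<le> h t"
    unfolding len bw_newton_def[symmetric] by blast
  define f where "f t = (\<Sum>k\<le>6. c k * bw_newton k t)" for t
  have sph: "C \<subseteq> sphere 0 1" and fin: "finite C" and card: "card C = 4320" and av: "avoiding T C"
    using C by (auto simp: admissible_codes_def spherical_code_def)
  \<comment> \<open>\<open>bw_dist_sum\<close> looks only at the six nodes, where \<open>f\<close>
    interpolates \<open>h\<close>.\<close>
  have "4320 * bw_dist_sum h = 4320 * bw_dist_sum f"
    unfolding bw_dist_sum_def using c(2) by (simp add: f_def bw_nodes_def)
  also have "\<dots> = (\<Sum>k\<le>6. c k * (4320 * (bw_newton k 1 + bw_dist_sum (bw_newton k)))) - 4320 * f 1"
    unfolding f_def bw_dist_sum_combination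
    by (simp add: distrib_left sum.distrib sum_distrib_left mult.left_commute)
  also have "\<dots> \<le> (\<Sum>k\<le>6. c k * (\<Sum>x\<in>C. \<Sum>y\<in>C. bw_newton k (x \<bullet> y))) - 4320 * f 1"
  proof (intro diff_right_mono sum_mono)
    fix k :: nat assume k: "k \<in> {..6}"
    show "c k * (4320 * (bw_newton k 1 + bw_dist_sum (bw_newton k))) \<le> c k * (\<Sum>x\<in>C. \<Sum>y\<in>C. bw_newton k (x \<bullet> y))"
    \<comment> \<open>The sign of \<open>c 0\<close> is unknown, but \<open>bw_newton 0\<close> is
      constantly 1 and the two sides agree, as \<open>1 + 4319 = 4320\<close>.\<close>
    proof (cases "k = 0")
      case True
      then show ?thesis by (simp add: bw_newton_def bw_dist_sum_def card)
    next
      case False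
      then show ?thesis
        using k c(1) bw_newton_pair_sum_lower_bound[OF sph card] by (intro mult_left_mono) auto
    qed
  qed
  also have "(\<Sum>k\<le>6. c k * (\<Sum>x\<in>C. \<Sum>y\<in>C. bw_newton k (x \<bullet> y))) = (\<Sum>x\<in>C. \<Sum>y\<in>C. f (x \<bullet> y))"
    unfolding f_def sum_distrib_left by (subst (2) sum.swap, subst sum.swap) simp
  \<comment> \<open>The diagonal pairs contribute \<open>f 1\<close> each, cancelling the
    \<open>4320 * f 1\<close> subtracted above.\<close>
  also have "\<dots> = (\<Sum>x\<in>C. f 1 + (\<Sum>y\<in>C - {x}. f (x \<bullet> y)))"
  proof (rule sum.cong[OF refl])
    fix x assume "x \<in> C"
    moreover from this have "x \<bullet> x = 1" using sph by (auto simp: dot_square_norm)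
    ultimately show "(\<Sum>y\<in>C. f (x \<bullet> y)) = f 1 + (\<Sum>y\<in>C - {x}. f (x \<bullet> y))"
      using fin by (simp add: sum.remove)
  qed
  also have "\<dots> - 4320 * f 1 = (\<Sum>x\<in>C. \<Sum>y\<in>C - {x}. f (x \<bullet> y))"
    by (simp add: sum.distrib card)
  also have "\<dots> \<le> (\<Sum>x\<in>C. \<Sum>y\<in>C - {x}. h (x \<bullet> y))"
  proof (intro sum_mono)
    fix x y assume "x \<in> C" "y \<in> C - {x}"
    moreover from this have "norm x = 1" "norm y = 1" using sph by auto
    ultimately have "x \<bullet> y \<in> {-1..<1}" "x \<bullet> y \<notin> T"
      using inner_unit_bounds[of x y] av by (auto simp: avoiding_def inner_products_def)
    then show "f (x \<bullet> y) \<le> h (x \<bullet> y)" unfolding f_def by (intro le d(3))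
  qed
  finally show ?thesis by (simp add: energy_eq_sum[OF fin])
qed

section \<open>Distance invariance of designs\<close>

lemma polynomial_of_degree_le_inner_power:
  fixes x :: "real^'n"
  assumes "k \<le> d"
  shows "polynomial_of_degree_le d (\<lambda>y. (x \<bullet> y) ^ k)"
  unfolding polynomial_of_degree_le_def
proof (intro exI[of _ "linpow k x"] ext)
  fix y :: "real^'n"
  have "(x \<bullet> y) ^ k = (\<Sum>\<alpha> | expo_deg \<alpha> = k. linpow k x \<alpha> * (\<Prod>i\<in>UNIV. (y $ i) ^ \<alpha> i))"
    using peval_linpow[of k y x] by (simp add: peval_def inner_commute)
  also have "\<dots> = (\<Sum>\<alpha> | (\<Sum>i\<in>UNIV. \<alpha> i) \<le> d. linpow k x \<alpha> * (\<Prod>i\<in>UNIV. (y $ i) ^ \<alpha> i))"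
    using assms finite_expo_deg_le[of d]
    by (intro sum.mono_neutral_left) (auto simp: expo_deg_def linpow_def)
  finally show "(x \<bullet> y) ^ k = (\<Sum>\<alpha> | (\<Sum>i\<in>UNIV. \<alpha> i) \<le> d. linpow k x \<alpha> * (\<Prod>i\<in>UNIV. (y $ i) ^ \<alpha> i))" .
qed

text \<open>The preimage is the image under the inverse map, which is orthogonal as well. Bounded
  sets have finite measure, and they suffice because the uniform measure lives on the unit
  ball.\<close>

lemma emeasure_lborel_orthogonal_vimage:
  fixes f :: "real^('n::{finite,wellorder}) \<Rightarrow> real^('n::{finite,wellorder})"
  assumes f: "orthogonal_transformation f" and X: "X \<in> sets borel" "bounded X"
  shows "emeasure lborel (f -` X) = emeasure lborel X"
proof -
  have g: "orthogonal_transformation (inv f)" by (rule orthogonal_transformation_inv[OF f])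
  have eq: "f -` X = inv f ` X" by (rule bij_vimage_eq_inv_image[OF orthogonal_transformation_bij[OF f]])
  have Xm: "X \<in> lmeasurable" using X by (intro bounded_set_imp_lmeasurable) auto
  have "continuous_on UNIV f"
    by (intro linear_continuous_on linear_conv_bounded_linear[THEN iffD1] orthogonal_transformation_linear f)
  then have fb: "f -` X \<in> sets borel" using X measurable_sets_borel[of f borel X] by (auto intro: borel_measurable_continuous_onI)
  have "emeasure lborel (f -` X) = emeasure lebesgue (inv f ` X)" using fb by (simp add: eq[symmetric])
  also have "\<dots> = ennreal (measure lebesgue (inv f ` X))"
    by (rule emeasure_eq_measure2[OF measurable_orthogonal_image[OF g Xm], unfolded])
  also have "\<dots> = ennreal (measure lebesgue X)" by (simp add: measure_orthogonal_image[OF g Xm])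
  also have "\<dots> = emeasure lebesgue X" using Xm by (simp add: emeasure_eq_measure2)
  also have "\<dots> = emeasure lborel X" using X by simp
  finally show ?thesis .
qed

text \<open>An orthogonal map preserves the punctured ball and its volume, and it commutes with the
  radial projection, so invariance passes to the pushed-forward measure.\<close>

lemma integral_sphere_measure_orthogonal:
  fixes f :: "real^('n::{finite,wellorder}) \<Rightarrow> real^('n::{finite,wellorder})" and p :: "real^('n::{finite,wellorder}) \<Rightarrow> real"
  assumes f: "orthogonal_transformation f" and p: "p \<in> borel_measurable borel"
  shows "(\<integral>y. p (f y) \<partial>sphere_measure) = (\<integral>y. p y \<partial>sphere_measure)"
proof -
  define B where "B = (ball 0 1 - {0} :: (real^('n::{finite,wellorder})) set)"
  define U where "U = uniform_measure lborel B"
  define s :: "real^('n::{finite,wellorder}) \<Rightarrow> real^('n::{finite,wellorder})" where "s = (\<lambda>y. y /\<^sub>R norm y)"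
  have lin: "linear f" by (rule orthogonal_transformation_linear[OF f])
  have [measurable]: "f \<in> borel_measurable borel"
    by (intro borel_measurable_continuous_onI linear_continuous_on linear_conv_bounded_linear[THEN iffD1] lin)
  have [measurable]: "s \<in> borel_measurable borel" unfolding s_def by measurable
  note p [measurable]
  have Bs: "B \<in> sets borel" by (simp add: B_def)
  have norm_f: "norm (f y) = norm y" for y by (rule orthogonal_transformation_norm[OF f])
  have fB: "f -` B = B"
    using norm_f by (auto simp: B_def) (metis norm_eq_zero norm_f)+
  have U: "distr U borel f = U"
  proof (rule measure_eqI)
    fix A assume "A \<in> sets (distr U borel f)"
    then have A: "A \<in> sets borel" by simp
    have "emeasure (distr U borel f) A = emeasure U (f -` A)"
      using A by (subst emeasure_distr) (auto simp: U_def)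
    also have "\<dots> = emeasure lborel (f -` (B \<inter> A)) / emeasure lborel B"
      using A Bs measurable_sets_borel[of f borel A] by (simp add: U_def fB)
    also have "emeasure lborel (f -` (B \<inter> A)) = emeasure lborel (B \<inter> A)"
      using A Bs by (intro emeasure_lborel_orthogonal_vimage f) (auto simp: B_def intro: bounded_subset[OF bounded_ball])
    also have "\<dots> / emeasure lborel B = emeasure U A" using A Bs by (simp add: U_def)
    finally show "emeasure (distr U borel f) A = emeasure U A" .
  qed (simp add: U_def)
  have [simp]: "sets U = sets borel" by (simp add: U_def)
  have S: "sphere_measure = distr U borel s" by (simp add: sphere_measure_def U_def B_def s_def)
  have sf: "s (f y) = f (s y)" for y by (simp add: s_def norm_f linear_scale[OF lin])
  have [measurable_cong]: "sets U = sets borel" by simp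
  have "(\<integral>y. p (f y) \<partial>sphere_measure) = (\<integral>y. p (f (s y)) \<partial>U)"
    unfolding S by (rule integral_distr) measurable
  also have "\<dots> = (\<integral>y. p (s y) \<partial>distr U borel f)"
    unfolding sf[symmetric] by (rule integral_distr[symmetric]) measurable
  also have "\<dots> = (\<integral>y. p y \<partial>sphere_measure)"
    unfolding U S by (rule integral_distr[symmetric]) measurable
  finally show ?thesis .
qed

text \<open>A rotation taking \<open>x\<close> to \<open>x'\<close> shows that the mean of each
  power of the inner product is the same for both; the design property transfers this to sums over
  \<open>C\<close>.\<close>

lemma spherical_design_poly_sum:
  fixes C :: "(real^('n::{finite,wellorder})) set"
  assumes C: "spherical_design d C" and p: "degree p \<le> d" and xy: "norm x = 1" "norm x' = 1"
  shows "(\<Sum>y\<in>C. poly p (x \<bullet> y)) = (\<Sum>y\<in>C. poly p (x' \<bullet> y))"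
proof (cases "C = {}")
  case False
  then have "card C \<noteq> 0" using C by (auto simp: spherical_design_def spherical_code_def)
  obtain f where f: "orthogonal_transformation f" "f x = x'"
    using orthogonal_transformation_exists_1[OF xy] by blast
  have pow: "(\<Sum>y\<in>C. (x \<bullet> y) ^ k) = (\<Sum>y\<in>C. (x' \<bullet> y) ^ k)" if "k \<le> d" for k
  proof -
    have avg: "(\<Sum>y\<in>C. (z \<bullet> y) ^ k) = real (card C) * (\<integral>y. (z \<bullet> y) ^ k \<partial>sphere_measure)" for z
      using C polynomial_of_degree_le_inner_power[OF that, of z] \<open>card C \<noteq> 0\<close>
      by (auto simp: spherical_design_def field_simps)
    have "(\<integral>y. (x' \<bullet> y) ^ k \<partial>sphere_measure) = (\<integral>y. (x' \<bullet> f y) ^ k \<partial>sphere_measure)"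
      by (rule integral_sphere_measure_orthogonal[OF f(1), symmetric]) measurable
    also have "\<dots> = (\<integral>y. (x \<bullet> y) ^ k \<partial>sphere_measure)"
      using f by (simp add: orthogonal_transformation_def flip: f(2))
    finally show ?thesis unfolding avg by simp
  qed
  have "(\<Sum>y\<in>C. poly p (z \<bullet> y)) = (\<Sum>k\<le>degree p. coeff p k * (\<Sum>y\<in>C. (z \<bullet> y) ^ k))" for z
    unfolding poly_altdef sum_distrib_left by (rule sum.swap)
  then show ?thesis using pow p by simp
qed simp

text \<open>The Lagrange polynomial \<open>p\<close> that is 1 at \<open>t\<close> and 0 at the
  other inner products has degree at most \<open>d\<close>. Summed over \<open>C\<close> from a
  point \<open>x\<close> it counts the \<open>y\<close> with inner product \<open>t\<close>, plus
  \<open>poly p 1\<close> for \<open>x\<close> itself, and the sum does not depend on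
  \<open>x\<close>.\<close>

theorem spherical_design_distance_invariant:
  fixes C :: "(real^('n::{finite,wellorder})) set"
  assumes C: "spherical_design d C" and card: "card (inner_products C) \<le> Suc d"
  shows "distance_invariant C"
  unfolding distance_invariant_def
proof (intro ballI)
  fix t assume t: "t \<in> inner_products C"
  have finC: "finite C" and sph: "C \<subseteq> sphere 0 1"
    using C by (auto simp: spherical_design_def spherical_code_def)
  let ?V = "inner_products C"
  have "?V \<subseteq> (\<lambda>(x, y). x \<bullet> y) ` (C \<times> C)" by (auto simp: inner_products_def)
  then have finV: "finite ?V" by (rule finite_subset) (use finC in auto)
  define q where "q = (\<Prod>s\<in>?V - {t}. [:-s, 1:])"
  define p where "p = smult (1 / poly q t) q"
  have nz: "poly q t \<noteq> 0" using finV by (auto simp: q_def poly_prod)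
  have "degree q \<le> card (?V - {t})"
    using degree_prod_sum_le[of "?V - {t}" "\<lambda>s. [:-s, 1:]"] finV by (simp add: q_def)
  then have deg: "degree p \<le> d" using card t finV nz by (simp add: p_def)
  have ind: "poly p u = (if u = t then 1 else 0)" if "u \<in> ?V" for u
    using that nz finV by (auto simp: p_def q_def poly_prod)
  have count: "real (card {y \<in> C. x \<bullet> y = t}) = (\<Sum>y\<in>C. poly p (x \<bullet> y)) - poly p 1" if x: "x \<in> C" for x
  proof -
    have xx: "x \<bullet> x = 1" using x sph by (auto simp: norm_eq_1)
    \<comment> \<open>Ensures that \<open>x\<close> itself is not among the points counted.\<close>
    have "t \<noteq> 1"
    proof -
      obtain a b where "t = a \<bullet> b" "a \<in> C" "b \<in> C" "a \<noteq> b" using t by (auto simp: inner_products_def)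
      moreover have "norm (a - b)^2 = 2 - 2 * (a \<bullet> b)"
        using calculation sph by (auto simp: power2_norm_eq_inner norm_eq_1 inner_diff inner_commute subset_iff)
      ultimately show ?thesis by auto
    qed
    have "(\<Sum>y\<in>C. poly p (x \<bullet> y)) = poly p 1 + (\<Sum>y\<in>C - {x}. poly p (x \<bullet> y))"
      using x finC by (simp add: sum.remove xx)
    also have "(\<Sum>y\<in>C - {x}. poly p (x \<bullet> y)) = (\<Sum>y\<in>C - {x}. if x \<bullet> y = t then 1 else 0)"
      using x by (intro sum.cong ind) (auto simp: inner_products_def)
    also have "\<dots> = (\<Sum>y\<in>C. if x \<bullet> y = t then 1 else 0)"
      using \<open>t \<noteq> 1\<close> xx finC by (intro sum.mono_neutral_left) auto
    also have "\<dots> = real (card {y \<in> C. x \<bullet> y = t})"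
      using finC by (simp add: sum.If_cases Int_def)
    finally show ?thesis by simp
  qed
  show "\<exists>a. \<forall>x\<in>C. card {y \<in> C. x \<bullet> y = t} = a"
  proof (cases "C = {}")
    case False
    then obtain x0 where x0: "x0 \<in> C" by auto
    have "card {y \<in> C. x \<bullet> y = t} = card {y \<in> C. x0 \<bullet> y = t}" if x: "x \<in> C" for x
    proof -
      have nx: "norm x = 1" "norm x0 = 1" using x x0 sph by auto
      have "real (card {y \<in> C. x \<bullet> y = t}) = real (card {y \<in> C. x0 \<bullet> y = t})"
        unfolding count[OF x] count[OF x0] using spherical_design_poly_sum[OF C deg nx] by simp
      then show ?thesis by simp
    qed
    then show ?thesis by blast
  qed simp
qed

section \<open>Sums over sign vectors\<close>

text \<open>The summand does not see the elements of \<open>B\<close>, each of which doubles the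
  sum.\<close>

lemma sum_Pow_Int:
  fixes \<phi> :: "'a set \<Rightarrow> real"
  assumes "finite A" "finite B" "A \<inter> B = {}"
  shows "(\<Sum>S\<in>Pow (A \<union> B). \<phi> (S \<inter> A)) = 2 ^ card B * (\<Sum>S\<in>Pow A. \<phi> S)"
  using assms(2,3)
proof (induction B rule: finite_induct)
  case empty
  then show ?case by (auto intro!: sum.cong simp: Int_absorb2)
next
  case (insert b B)
  have b: "b \<notin> A \<union> B" using insert by auto
  have "Pow (A \<union> insert b B) = Pow (A \<union> B) \<union> insert b ` Pow (A \<union> B)"
    using Pow_insert[of b "A \<union> B"] by simp
  moreover have "Pow (A \<union> B) \<inter> insert b ` Pow (A \<union> B) = {}" using b by auto
  moreover have "inj_on (insert b) (Pow (A \<union> B))"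
    using b by (intro inj_onI) (metis Diff_insert_absorb PowD in_mono)
  moreover have "insert b S \<inter> A = S \<inter> A" for S using b by auto
  ultimately have "(\<Sum>S\<in>Pow (A \<union> insert b B). \<phi> (S \<inter> A)) = 2 * (\<Sum>S\<in>Pow (A \<union> B). \<phi> (S \<inter> A))"
    using assms(1) insert.hyps by (simp add: sum.union_disjoint sum.reindex)
  then show ?case using insert by simp
qed

text \<open>One element of \<open>B\<close> serves as a parity bit: the rest of an even subset is
  arbitrary and determines whether that element belongs to it. Hence the exponent
  \<open>card B - 1\<close>.\<close>

lemma sum_even_subsets:
  fixes \<phi> :: "'a set \<Rightarrow> real"
  assumes "finite A" "finite B" "A \<inter> B = {}" "B \<noteq> {}"
  shows "(\<Sum>S | S \<subseteq> A \<union> B \<and> even (card S). \<phi> (S \<inter> A)) = 2 ^ (card B - 1) * (\<Sum>S\<in>Pow A. \<phi> S)"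
proof -
  obtain b where b: "b \<in> B" using assms by auto
  let ?B = "B - {b}"
  have fin: "finite S" if "S \<subseteq> A \<union> B" for S using that assms finite_subset by blast
  have "(\<Sum>S | S \<subseteq> A \<union> B \<and> even (card S). \<phi> (S \<inter> A)) = (\<Sum>S\<in>Pow (A \<union> ?B). \<phi> (S \<inter> A))"
  proof (rule sum.reindex_bij_witness[of _ "\<lambda>S. if even (card S) then S else insert b S" "\<lambda>S. S - {b}"])
    fix S assume S: "S \<in> {S. S \<subseteq> A \<union> B \<and> even (card S)}"
    then have f: "finite S" using fin by auto
    show "(if even (card (S - {b})) then S - {b} else insert b (S - {b})) = S"
    proof (cases "b \<in> S")
      case True
      then have "card S = Suc (card (S - {b}))" using f by (metis card.remove)
      then show ?thesis using S True by auto
    next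
      case False
      then show ?thesis using S by auto
    qed
    show "\<phi> ((S - {b}) \<inter> A) = \<phi> (S \<inter> A)" using b assms by (intro arg_cong[of _ _ \<phi>]) auto
  next
    fix S assume S: "S \<in> Pow (A \<union> ?B)"
    then have bS: "b \<notin> S" "finite S" using b assms fin[of S] by auto
    show "(if even (card S) then S else insert b S) - {b} = S" using bS by auto
    show "(if even (card S) then S else insert b S) \<in> {S. S \<subseteq> A \<union> B \<and> even (card S)}"
      using S b bS by auto
  qed (use assms b in auto)
  also have "\<dots> = 2 ^ card ?B * (\<Sum>S\<in>Pow A. \<phi> S)"
    using assms by (intro sum_Pow_Int) auto
  finally show ?thesis using b assms by simp
qed

abbreviation symdiff :: "'a set \<Rightarrow> 'a set \<Rightarrow> 'a set" where
  "symdiff A B \<equiv> (A - B) \<union> (B - A)"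

lemma card_symdiff:
  assumes "finite A" "finite B"
  shows "card (symdiff A B) + 2 * card (A \<inter> B) = card A + card B"
proof -
  have "card (symdiff A B) = card (A - B) + card (B - A)"
    using assms by (intro card_Un_disjoint) auto
  moreover have "card A = card (A \<inter> B) + card (A - B)" "card B = card (A \<inter> B) + card (B - A)"
    using assms by (simp_all add: card_Int_Diff[of A _] card_Int_Diff[of B A] Int_commute)
  ultimately show ?thesis by simp
qed

lemma sum_Pow_symdiff:
  assumes "S0 \<subseteq> A"
  shows "(\<Sum>S\<in>Pow A. \<phi> (symdiff S S0)) = (\<Sum>S\<in>Pow A. \<phi> S)"
  by (rule sum.reindex_bij_witness[of _ "\<lambda>S. symdiff S S0" "\<lambda>S. symdiff S S0"]) (use assms in auto)

lemma sum_Pow_card: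
  fixes \<phi> :: "nat \<Rightarrow> real"
  assumes "finite A"
  shows "(\<Sum>S\<in>Pow A. \<phi> (card S)) = (\<Sum>k\<le>card A. real (card A choose k) * \<phi> k)"
proof -
  have "(\<Sum>S\<in>Pow A. \<phi> (card S)) = (\<Sum>k\<le>card A. \<Sum>S | S \<in> Pow A \<and> card S = k. \<phi> (card S))"
    using assms by (intro sum.group[symmetric]) (auto intro: card_mono)
  also have "\<dots> = (\<Sum>k\<le>card A. real (card A choose k) * \<phi> k)"
    using assms by (intro sum.cong) (auto simp: n_subsets)
  finally show ?thesis .
qed

section \<open>Inner products of sign vectors\<close>

definition signed :: "'n set \<Rightarrow> 'n set \<Rightarrow> int^'n" where
  "signed c S = (\<chi> i. if i \<in> c then if i \<in> S then - 1 else 1 else 0)"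

definition iprod :: "int^'n \<Rightarrow> int^'n \<Rightarrow> int" where
  "iprod z w = (\<Sum>i\<in>UNIV. z $ i * w $ i)"

lemma iprod_signed:
  fixes c :: "'n::finite set"
  shows "iprod (signed c S) (signed c' S') =
    int (card (c \<inter> c')) - 2 * int (card (symdiff S' S \<inter> (c \<inter> c')))"
proof -
  have "iprod (signed c S) (signed c' S') =
      (\<Sum>i\<in>UNIV. of_bool (i \<in> c \<inter> c') - 2 * of_bool (i \<in> symdiff S' S \<inter> (c \<inter> c')))"
    unfolding iprod_def signed_def by (intro sum.cong) auto
  also have "\<dots> = (\<Sum>i\<in>UNIV. of_bool (i \<in> c \<inter> c')) - 2 * (\<Sum>i\<in>UNIV. of_bool (i \<in> symdiff S' S \<inter> (c \<inter> c')))"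
    by (simp only: sum_subtractf sum_distrib_left)
  finally show ?thesis by (simp only: sum_of_bool_eq finite Int_UNIV_left Collect_mem_eq of_nat_id)
qed

lemma iprod_scale: "iprod (a *s z) w = a * iprod z w" "iprod z (a *s w) = a * iprod z w"
  by (simp_all add: iprod_def sum_distrib_left mult_ac)

lemma signed_inject:
  assumes "S \<subseteq> c" "S' \<subseteq> c'" "signed c S = signed c' S'"
  shows "c = c' \<and> S = S'"
proof -
  have "(if i \<in> c then if i \<in> S then - 1 else 1 else 0 :: int) = (if i \<in> c' then if i \<in> S' then - 1 else 1 else 0)" for i
    using assms(3) by (simp add: signed_def vec_eq_iff)
  then have "(i \<in> c \<longleftrightarrow> i \<in> c') \<and> (i \<in> S \<longleftrightarrow> i \<in> S')" for i
    using assms(1,2) by (smt (verit) in_mono)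
  then show ?thesis by blast
qed

text \<open>The sum of \<open>g\<close> over the inner products of a fixed sign vector with the sign vectors of length \<open>n\<close>, scaled by \<open>m\<close>.\<close>

definition sign_sum :: "(int \<Rightarrow> real) \<Rightarrow> int \<Rightarrow> nat \<Rightarrow> real" where
  "sign_sum g m n = (\<Sum>k\<le>n. real (n choose k) * g (m * (int n - 2 * int k)))"

lemma sum_Pow_sign_sum:
  assumes "finite A" "S0 \<subseteq> A"
  shows "(\<Sum>S\<in>Pow A. g (m * (int (card A) - 2 * int (card (symdiff S S0))))) = sign_sum g m (card A)"
  using sum_Pow_symdiff[OF assms(2), of "\<lambda>S. g (m * (int (card A) - 2 * int (card S)))"]
    sum_Pow_card[OF assms(1), of "\<lambda>k. g (m * (int (card A) - 2 * int k))"]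
  by (simp add: sign_sum_def)

lemma symdiff_Int: "symdiff S S0 \<inter> I = symdiff (S \<inter> I) (S0 \<inter> I)"
  by auto

lemma sum_signed:
  fixes c c' :: "'n::finite set"
  shows "(\<Sum>S\<in>Pow c'. g (m * iprod (signed c S0) (signed c' S))) =
    2 ^ card (c' - c) * sign_sum g m (card (c \<inter> c'))"
proof -
  let ?I = "c \<inter> c'"
  have c': "?I \<union> (c' - c) = c'" and disj: "?I \<inter> (c' - c) = {}" by auto
  show ?thesis
    unfolding iprod_signed symdiff_Int sum_Pow_sign_sum[OF finite Int_lower2, symmetric, of g m ?I S0]
    using sum_Pow_Int[OF finite finite disj, of "\<lambda>S. g (m * (int (card ?I) - 2 * int (card (symdiff S (S0 \<inter> ?I)))))"]
    unfolding c' .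
qed

text \<open>The assumption provides a coordinate of \<open>c'\<close> outside \<open>c\<close> that
  can absorb the parity condition.\<close>

lemma sum_signed_even:
  fixes c c' :: "'n::finite set"
  assumes "\<not> c' \<subseteq> c"
  shows "(\<Sum>S | S \<subseteq> c' \<and> even (card S). g (m * iprod (signed c S0) (signed c' S))) =
    2 ^ (card (c' - c) - 1) * sign_sum g m (card (c \<inter> c'))"
proof -
  let ?I = "c \<inter> c'"
  have c': "?I \<union> (c' - c) = c'" and disj: "?I \<inter> (c' - c) = {}" by auto
  show ?thesis
    unfolding iprod_signed symdiff_Int sum_Pow_sign_sum[OF finite Int_lower2, symmetric, of g m ?I S0]
    using sum_even_subsets[OF finite finite disj, of "\<lambda>S. g (m * (int (card ?I) - 2 * int (card (symdiff S (S0 \<inter> ?I)))))"] assms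
    unfolding c' by blast
qed

text \<open>With equal supports no coordinate is free to absorb the parity. Instead, symmetric
  difference with the even set \<open>S0\<close> preserves parity, so only even numbers of sign
  changes occur.\<close>

lemma sum_signed_even_self:
  fixes c :: "'n::finite set"
  assumes "S0 \<subseteq> c" "even (card S0)"
  shows "(\<Sum>S | S \<subseteq> c \<and> even (card S). g (iprod (signed c S0) (signed c S))) =
    (\<Sum>k\<le>card c. real (card c choose k) * (if even k then g (int (card c) - 2 * int k) else 0))"
proof -
  define \<phi> where "\<phi> k = (if even k then g (int (card c) - 2 * int k) else 0)" for k
  have "even (card (symdiff S S0)) \<longleftrightarrow> even (card S)" for S
    using card_symdiff[of S S0] assms(2) by (metis even_add even_mult_iff even_numeral finite)
  moreover have "symdiff S S0 \<inter> c = symdiff S S0" if "S \<subseteq> c" for S using that assms(1) by auto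
  ultimately have "(\<Sum>S | S \<subseteq> c \<and> even (card S). g (iprod (signed c S0) (signed c S))) =
      (\<Sum>S\<in>Pow c. \<phi> (card (symdiff S S0)))"
    by (intro sum.mono_neutral_cong_left) (auto simp: iprod_signed \<phi>_def)
  also have "\<dots> = (\<Sum>k\<le>card c. real (card c choose k) * \<phi> k)"
    using sum_Pow_symdiff[OF assms(1), of "\<lambda>S. \<phi> (card S)"] by (simp add: sum_Pow_card)
  finally show ?thesis unfolding \<phi>_def .
qed

lemma sum_subsets_card_Int:
  fixes F :: "nat \<Rightarrow> real" and c :: "'n::finite set"
  shows "(\<Sum>c' | card c' = n. F (card (c \<inter> c'))) =
    (\<Sum>j\<le>n. real (card c choose j) * real (card (- c) choose (n - j)) * F j)"
proof -
  have "(\<Sum>c' | card c' = n. F (card (c \<inter> c'))) =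
      (\<Sum>j\<le>n. \<Sum>c' | c' \<in> {c'. card c' = n} \<and> card (c \<inter> c') = j. F (card (c \<inter> c')))"
    by (intro sum.group[symmetric]) (auto intro: card_mono)
  also have "\<dots> = (\<Sum>j\<le>n. real (card c choose j) * real (card (- c) choose (n - j)) * F j)"
  proof (rule sum.cong[OF refl])
    fix j assume j: "j \<in> {..n}"
    let ?P = "{U. U \<subseteq> c \<and> card U = j} \<times> {V. V \<subseteq> - c \<and> card V = n - j}"
    have "bij_betw (\<lambda>(U, V). U \<union> V) ?P {c'. card c' = n \<and> card (c \<inter> c') = j}"
    proof (rule bij_betw_byWitness[where f' = "\<lambda>c'. (c \<inter> c', c' - c)"])
      show "(\<lambda>(U, V). U \<union> V) ` ?P \<subseteq> {c'. card c' = n \<and> card (c \<inter> c') = j}"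
      proof clarsimp
        fix U V assume UV: "U \<subseteq> c" "V \<subseteq> - c" "j = card U" "card V = n - card U"
        then have "card (U \<union> V) = card U + card V" by (intro card_Un_disjoint) auto
        moreover have "c \<inter> (U \<union> V) = U" using UV by auto
        ultimately show "card (U \<union> V) = n \<and> card (c \<inter> (U \<union> V)) = card U" using UV j by simp
      qed
      show "(\<lambda>c'. (c \<inter> c', c' - c)) ` {c'. card c' = n \<and> card (c \<inter> c') = j} \<subseteq> ?P"
        by (auto simp: card_Diff_subset_Int Int_commute)
    qed auto
    then have "card {c'. card c' = n \<and> card (c \<inter> c') = j} = card ?P" by (simp add: bij_betw_same_card)
    also have "\<dots> = (card c choose j) * (card (- c) choose (n - j))"
      by (simp add: card_cartesian_product n_subsets)
    finally show "(\<Sum>c' | c' \<in> {c'. card c' = n} \<and> card (c \<inter> c') = j. F (card (c \<inter> c'))) =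
        real (card c choose j) * real (card (- c) choose (n - j)) * F j" by simp
  qed
  finally show ?thesis .
qed

section \<open>The first-order Reed--Muller code\<close>

lemma UNIV_16: "(UNIV :: 16 set) = of_nat ` {..<16}"
proof -
  have "x \<in> of_nat ` {..<16}" for x :: 16
  proof (induction x rule: bit0.induct)
    case (1 z)
    then show ?case by (intro image_eqI[of _ _ "nat z"]) auto
  qed
  then show ?thesis by auto
qed

lemma inj_on_of_nat_16: "inj_on (of_nat :: nat \<Rightarrow> 16) {..<16}"
  by (rule eq_card_imp_inj_on) (simp_all flip: UNIV_16)

text \<open>An affine function over the field with two elements, with constant term
  \<open>b\<close>, evaluated at the binary digits of \<open>k\<close>; addition is
  \<open>\<noteq>\<close>. Words are then kept as their supports, so that their sum is the symmetric
  difference.\<close>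

definition rm_bit :: "bool \<times> bool \<times> bool \<times> bool \<times> bool \<Rightarrow> nat \<Rightarrow> bool" where
  "rm_bit = (\<lambda>(b, a0, a1, a2, a3) k. b \<noteq> ((a0 \<and> odd k) \<noteq> ((a1 \<and> odd (k div 2)) \<noteq>
     ((a2 \<and> odd (k div 4)) \<noteq> (a3 \<and> odd (k div 8))))))"

definition rm_word :: "bool \<times> bool \<times> bool \<times> bool \<times> bool \<Rightarrow> 16 set" where
  "rm_word p = of_nat ` {k. k < 16 \<and> rm_bit p k}"

definition rm_code :: "16 set set" where
  "rm_code = range rm_word"

lemma of_nat_mem_rm_word: "k < 16 \<Longrightarrow> of_nat k \<in> rm_word p \<longleftrightarrow> rm_bit p k"
  unfolding rm_word_def using inj_on_of_nat_16 by (auto dest: inj_onD)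

lemma set_16_eqI:
  assumes "\<And>k. k < 16 \<Longrightarrow> (of_nat k :: 16) \<in> A \<longleftrightarrow> of_nat k \<in> B"
  shows "A = B"
proof (rule set_eqI)
  fix x :: 16
  have "x \<in> of_nat ` {..<16}" using UNIV_16 by auto
  then show "x \<in> A \<longleftrightarrow> x \<in> B" using assms by auto
qed

lemma rm_code_symdiff:
  assumes "c \<in> rm_code" "c' \<in> rm_code"
  shows "symdiff c c' \<in> rm_code"
proof -
  obtain b a0 a1 a2 a3 b' a0' a1' a2' a3'
    where c: "c = rm_word (b, a0, a1, a2, a3)" "c' = rm_word (b', a0', a1', a2', a3')"
    using assms unfolding rm_code_def by (metis rangeE surj_pair)
  have "symdiff c c' = rm_word (b \<noteq> b', a0 \<noteq> a0', a1 \<noteq> a1', a2 \<noteq> a2', a3 \<noteq> a3')"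
  proof (rule set_16_eqI)
    fix k :: nat assume k: "k < 16"
    have xor: "((b \<noteq> b') \<noteq> (r \<noteq> r')) \<longleftrightarrow> ((b \<noteq> r) \<noteq> (b' \<noteq> r'))"
      "((b \<noteq> b') \<and> t) \<longleftrightarrow> ((b \<and> t) \<noteq> (b' \<and> t))" for b b' r r' t by blast+
    have "rm_bit (b \<noteq> b', a0 \<noteq> a0', a1 \<noteq> a1', a2 \<noteq> a2', a3 \<noteq> a3') k \<longleftrightarrow>
        rm_bit (b, a0, a1, a2, a3) k \<noteq> rm_bit (b', a0', a1', a2', a3') k"
      unfolding rm_bit_def prod.case xor by (rule refl)
    then show "of_nat k \<in> symdiff c c' \<longleftrightarrow>
        of_nat k \<in> rm_word (b \<noteq> b', a0 \<noteq> a0', a1 \<noteq> a1', a2 \<noteq> a2', a3 \<noteq> a3')"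
      by (auto simp: c of_nat_mem_rm_word[OF k])
  qed
  then show ?thesis by (auto simp: rm_code_def)
qed

lemma rm_word_trivial: "rm_word (False, False, False, False, False) = {}"
    "rm_word (True, False, False, False, False) = UNIV"
  by (auto intro!: set_16_eqI simp: of_nat_mem_rm_word rm_bit_def)

lemma rm_code_trivial: "{} \<in> rm_code" "UNIV \<in> rm_code"
  using rm_word_trivial by (metis rm_code_def rangeI)+

lemma card_rm_word: "card (rm_word p) = length (filter (rm_bit p) [0..<16])"
proof -
  have "card (rm_word p) = card {k. k < 16 \<and> rm_bit p k}"
    unfolding rm_word_def by (intro card_image inj_on_subset[OF inj_on_of_nat_16]) auto
  also have "{k. k < 16 \<and> rm_bit p k} = set (filter (rm_bit p) [0..<16])" by auto
  finally show ?thesis by (simp only: distinct_card distinct_filter distinct_upt)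
qed

lemma rm_code_weight:
  assumes "c \<in> rm_code" "c \<noteq> {}" "c \<noteq> UNIV"
  shows "card c = 8"
proof -
  obtain b a0 a1 a2 a3 where c: "c = rm_word (b, a0, a1, a2, a3)"
    using assms(1) unfolding rm_code_def by (metis rangeE surj_pair)
  then have "a0 \<or> a1 \<or> a2 \<or> a3" using assms rm_word_trivial by (cases b) auto
  then show ?thesis
    unfolding c card_rm_word
    by (cases b; cases a0; cases a1; cases a2; cases a3) (simp_all add: rm_bit_def upt_rec[of _ 16])
qed

lemma inj_rm_word: "inj rm_word"
proof (rule injI)
  fix p q assume eq: "rm_word p = rm_word q"
  obtain b a0 a1 a2 a3 b' a0' a1' a2' a3'
    where pq: "p = (b, a0, a1, a2, a3)" "q = (b', a0', a1', a2', a3')" by (metis surj_pair)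
  have "rm_bit p k = rm_bit q k" if "k < 16" for k using eq of_nat_mem_rm_word[OF that] by metis
  \<comment> \<open>The value at 0 is the constant term; 1, 2, 4 and 8 are the unit vectors and give
    the linear coefficients.\<close>
  from this[of 0] this[of 1] this[of 2] this[of 4] this[of 8] show "p = q"
    by (auto simp: pq rm_bit_def)
qed

lemma card_rm_code: "card rm_code = 32"
  unfolding rm_code_def card_image[OF inj_rm_word]
  by (simp add: card_cartesian_product flip: UNIV_Times_UNIV)

definition rm_code8 :: "16 set set" where
  "rm_code8 = rm_code - {{}, UNIV}"

lemma card_rm_code8: "card rm_code8 = 30"
  unfolding rm_code8_def using rm_code_trivial by (subst card_Diff_subset) (auto simp: card_rm_code)

lemma card_mem_rm_code8: "c \<in> rm_code8 \<Longrightarrow> card c = 8"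
  using rm_code_weight by (auto simp: rm_code8_def)

lemma Compl_eq_symdiff_UNIV: "- c = symdiff c UNIV"
  by auto

lemma Compl_mem_rm_code8: "c \<in> rm_code8 \<Longrightarrow> - c \<in> rm_code8"
  using rm_code_symdiff[OF _ rm_code_trivial(2), of c, folded Compl_eq_symdiff_UNIV] by (auto simp: rm_code8_def)

text \<open>The sum of two such words is again of weight 8, and
  \<open>8 = 8 + 8 - 2 * 4\<close>.\<close>

lemma rm_code8_card_Int:
  assumes "c \<in> rm_code8" "c' \<in> rm_code8" "c' \<noteq> c" "c' \<noteq> - c"
  shows "card (c \<inter> c') = 4"
proof -
  have "symdiff c c' \<in> rm_code" using assms by (auto simp: rm_code8_def intro!: rm_code_symdiff)
  moreover have "symdiff c c' \<noteq> {}" "symdiff c c' \<noteq> UNIV" using assms by auto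
  ultimately have "card (symdiff c c') = 8" by (rule rm_code_weight)
  then show ?thesis using card_symdiff[of c c'] card_mem_rm_code8 assms by simp
qed

lemma sum_rm_code8:
  fixes F :: "16 set \<Rightarrow> real"
  assumes "c \<in> rm_code8" "\<And>c'. c' \<in> rm_code8 \<Longrightarrow> card (c \<inter> c') = 4 \<Longrightarrow> F c' = v"
  shows "(\<Sum>c'\<in>rm_code8. F c') = F c + F (- c) + 28 * v"
proof -
  have c: "c \<in> rm_code8" "- c \<in> rm_code8" "c \<noteq> - c" using assms(1) Compl_mem_rm_code8 by auto
  have "(\<Sum>c'\<in>rm_code8. F c') = (\<Sum>c'\<in>{c, - c}. F c') + (\<Sum>c'\<in>rm_code8 - {c, - c}. F c')"
    using c by (intro sum.subset_diff[THEN trans[OF _ add.commute]]) auto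
  also have "(\<Sum>c'\<in>rm_code8 - {c, - c}. F c') = (\<Sum>c'\<in>rm_code8 - {c, - c}. v)"
    using assms rm_code8_card_Int by (intro sum.cong) auto
  also have "\<dots> = 28 * v" using c by (simp add: card_Diff_subset card_rm_code8)
  finally show ?thesis using c by simp
qed

lemma rm_code_separates:
  assumes "i \<noteq> j"
  shows "\<exists>c\<in>rm_code. i \<in> c \<and> j \<notin> c"
proof -
  obtain k l where kl: "i = of_nat k" "j = of_nat l" "k < 16" "l < 16" using UNIV_16 by (metis UNIV_I image_iff lessThan_iff)
  have kl': "k \<noteq> l" using assms kl by auto
  have "\<exists>p. rm_bit p k \<and> \<not> rm_bit p l"
  proof (rule ccontr)
    assume "\<not> ?thesis"
    then have *: "rm_bit p k \<longrightarrow> rm_bit p l" for p by blast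
    \<comment> \<open>For each binary digit, a word and its complement turn the implication into an
      equivalence; then \<open>k\<close> and \<open>l\<close> are rebuilt from the top digit
      down.\<close>
    have 0: "odd k = odd l"
      using *[of "(False, True, False, False, False)"] *[of "(True, True, False, False, False)"] by (auto simp: rm_bit_def)
    have 1: "odd (k div 2) = odd (l div 2)"
      using *[of "(False, False, True, False, False)"] *[of "(True, False, True, False, False)"] by (auto simp: rm_bit_def)
    have 2: "odd (k div 4) = odd (l div 4)"
      using *[of "(False, False, False, True, False)"] *[of "(True, False, False, True, False)"] by (auto simp: rm_bit_def)
    have 3: "odd (k div 8) = odd (l div 8)"
      using *[of "(False, False, False, False, True)"] *[of "(True, False, False, False, True)"] by (auto simp: rm_bit_def)
    have step: "x = y" if "x div 2 = y div 2" "odd x = odd y" for x y :: nat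
      using that by presburger
    have "k div 16 = l div 16" using kl by simp
    then have 8: "k div 8 = l div 8" using 3 step[of "k div 8" "l div 8"] by (simp flip: div_mult2_eq)
    then have 4: "k div 4 = l div 4" using 2 step[of "k div 4" "l div 4"] by (simp flip: div_mult2_eq)
    then have "k div 2 = l div 2" using 1 step[of "k div 2" "l div 2"] by (simp flip: div_mult2_eq)
    then show False using 0 step kl' by blast
  qed
  then show ?thesis using kl of_nat_mem_rm_word by (metis rangeI rm_code_def)
qed

lemma symdiff_cancel: "symdiff (symdiff A B) B = A"
  by auto

text \<open>Adding a word that separates \<open>i\<close> from \<open>j\<close> exchanges the words
  that agree at \<open>i\<close> and \<open>j\<close> with those that differ, 16 each; adding
  \<open>UNIV\<close> exchanges the two kinds of agreement, 8 each. Removing \<open>UNIV\<close> and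
  the empty word leaves 7.\<close>

lemma rm_code_pair_counts:
  fixes i j :: 16
  assumes "i \<noteq> j"
  shows "card {c \<in> rm_code8. i \<in> c \<and> j \<in> c} = 7" "card {c \<in> rm_code8. i \<notin> c \<and> j \<notin> c} = 7"
    "card {c \<in> rm_code8. (i \<in> c) \<noteq> (j \<in> c)} = 16"
proof -
  obtain v where v: "v \<in> rm_code" "i \<in> v" "j \<notin> v" using rm_code_separates[OF assms] by auto
  let ?A = "{c \<in> rm_code. (i \<in> c) \<noteq> (j \<in> c)}" and ?B = "{c \<in> rm_code. (i \<in> c) = (j \<in> c)}"
  let ?TT = "{c \<in> rm_code. i \<in> c \<and> j \<in> c}" and ?FF = "{c \<in> rm_code. i \<notin> c \<and> j \<notin> c}"
  have bij: "card {c \<in> rm_code. P c} = card {c \<in> rm_code. Q c}"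
    if "u \<in> rm_code" "\<And>c. P c \<Longrightarrow> Q (symdiff c u)" "\<And>c. Q c \<Longrightarrow> P (symdiff c u)" for u P Q
  proof (rule bij_betw_same_card[of "\<lambda>c. symdiff c u"])
    have "symdiff c u \<in> {c \<in> rm_code. Q c}" if "c \<in> {c \<in> rm_code. P c}" for c
      using that \<open>u \<in> rm_code\<close> \<open>\<And>c. P c \<Longrightarrow> Q (symdiff c u)\<close> rm_code_symdiff by blast
    moreover have "symdiff c u \<in> {c \<in> rm_code. P c}" if "c \<in> {c \<in> rm_code. Q c}" for c
      using that \<open>u \<in> rm_code\<close> \<open>\<And>c. Q c \<Longrightarrow> P (symdiff c u)\<close> rm_code_symdiff by blast
    ultimately show "bij_betw (\<lambda>c. symdiff c u) {c \<in> rm_code. P c} {c \<in> rm_code. Q c}"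
      by (intro bij_betw_byWitness[where f' = "\<lambda>c. symdiff c u"] ballI image_subsetI symdiff_cancel)
  qed
  have "card ?A + card ?B = 32"
  proof -
    have "rm_code = ?A \<union> ?B" by auto
    then have "card rm_code = card ?A + card ?B" by (subst card_Un_disjoint[symmetric]) auto
    then show ?thesis by (simp add: card_rm_code)
  qed
  moreover have "card ?A = card ?B" by (rule bij[OF v(1)]) (use v in auto)
  ultimately have A: "card ?A = 16" "card ?B = 16" by auto
  have "?B = ?TT \<union> ?FF" by auto
  then have "card ?B = card ?TT + card ?FF" by (subst card_Un_disjoint[symmetric]) auto
  moreover have "card ?TT = card ?FF" by (rule bij[OF rm_code_trivial(2)]) auto
  ultimately have B: "card ?TT = 8" "card ?FF = 8" using A by auto
  have "{c \<in> rm_code8. i \<in> c \<and> j \<in> c} = ?TT - {UNIV}" "{c \<in> rm_code8. i \<notin> c \<and> j \<notin> c} = ?FF - {{}}"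
    "{c \<in> rm_code8. (i \<in> c) \<noteq> (j \<in> c)} = ?A"
    by (auto simp: rm_code8_def)
  then show "card {c \<in> rm_code8. i \<in> c \<and> j \<in> c} = 7" "card {c \<in> rm_code8. i \<notin> c \<and> j \<notin> c} = 7"
    "card {c \<in> rm_code8. (i \<in> c) \<noteq> (j \<in> c)} = 16"
    using A B rm_code_trivial by simp_all
qed

lemma sum_rm_code8_pair:
  fixes F :: "nat \<Rightarrow> real"
  assumes "card (c :: 16 set) = 2"
  shows "(\<Sum>c'\<in>rm_code8. F (card (c \<inter> c'))) = 7 * F 2 + 16 * F 1 + 7 * F 0"
proof -
  obtain i j where c: "c = {i, j}" "i \<noteq> j" using assms by (auto simp: card_2_iff)
  let ?T = "{c \<in> rm_code8. i \<in> c \<and> j \<in> c}" and ?F = "{c \<in> rm_code8. i \<notin> c \<and> j \<notin> c}"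
    and ?D = "{c \<in> rm_code8. (i \<in> c) \<noteq> (j \<in> c)}"
  have "rm_code8 = ?T \<union> (?D \<union> ?F)" by auto
  then have "(\<Sum>c'\<in>rm_code8. F (card (c \<inter> c'))) = (\<Sum>c'\<in>?T \<union> (?D \<union> ?F). F (card (c \<inter> c')))" by simp
  also have "\<dots> = (\<Sum>c'\<in>?T. F (card (c \<inter> c'))) + ((\<Sum>c'\<in>?D. F (card (c \<inter> c'))) + (\<Sum>c'\<in>?F. F (card (c \<inter> c'))))"
    by (subst sum.union_disjoint, simp, simp, blast, subst sum.union_disjoint) auto
  also have "(\<Sum>c'\<in>?T. F (card (c \<inter> c'))) = (\<Sum>c'\<in>?T. F 2)"
    using c by (intro sum.cong) (auto simp: Int_insert_left simp flip: numeral_2_eq_2)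
  also have "(\<Sum>c'\<in>?D. F (card (c \<inter> c'))) = (\<Sum>c'\<in>?D. F 1)"
    using c by (intro sum.cong) (auto simp: Int_insert_left simp flip: numeral_2_eq_2)
  also have "(\<Sum>c'\<in>?F. F (card (c \<inter> c'))) = (\<Sum>c'\<in>?F. F 0)"
    using c by (intro sum.cong) (auto simp: Int_insert_left simp flip: numeral_2_eq_2)
  finally show ?thesis using rm_code_pair_counts[OF c(2)] by simp
qed

lemma mod2_in_reed_muller_iff: "mod2_in_reed_muller z \<longleftrightarrow> {i. odd (z $ i)} \<in> rm_code"
proof -
  have mod2: "x mod 2 = y mod 2 \<longleftrightarrow> odd x = odd y" for x y :: int by presburger
  have sum4: "(\<Sum>j<4. f j) = f 0 + (f 1 + (f 2 + f 3))" for f :: "nat \<Rightarrow> int"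
    by (simp add: eval_nat_numeral)
  have odd_prod: "odd (x * int (m mod 2)) \<longleftrightarrow> odd x \<and> odd m" for x m by simp
  have pow: "k div 2 ^ 0 = k" "k div 2 ^ 1 = k div 2" "k div 2 ^ 2 = k div 4" "k div 2 ^ 3 = k div 8"
    for k :: nat by simp_all
  have bit: "odd (b + (\<Sum>j<4. a j * int (k div 2 ^ j mod 2))) \<longleftrightarrow>
      rm_bit (odd b, odd (a 0), odd (a 1), odd (a 2), odd (a 3)) k" for b a k
    unfolding sum4 odd_add odd_prod pow rm_bit_def prod.case ..
  have "mod2_in_reed_muller z \<longleftrightarrow> (\<exists>(b::int) (a::nat \<Rightarrow> int). \<forall>k<16. odd (z $ of_nat k) =
      rm_bit (odd b, odd (a 0), odd (a 1), odd (a 2), odd (a 3)) k)"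
    unfolding mod2_in_reed_muller_def mod2 bit ..
  also have "\<dots> \<longleftrightarrow> (\<exists>p. \<forall>k<16. odd (z $ of_nat k) = rm_bit p k)"
  proof
    assume "\<exists>p. \<forall>k<16. odd (z $ of_nat k) = rm_bit p k"
    then obtain b a0 a1 a2 a3 where p: "\<forall>k<16. odd (z $ of_nat k) = rm_bit (b, a0, a1, a2, a3) k"
      by (metis surj_pair)
    show "\<exists>(b::int) (a::nat \<Rightarrow> int). \<forall>k<16. odd (z $ of_nat k) =
      rm_bit (odd b, odd (a 0), odd (a 1), odd (a 2), odd (a 3)) k"
      by (rule exI[of _ "of_bool b"],
          rule exI[of _ "\<lambda>j. of_bool ([a0, a1, a2, a3] ! j)"]) (use p in \<open>simp add: numeral_2_eq_2 numeral_3_eq_3\<close>)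
  qed blast
  also have "\<dots> \<longleftrightarrow> {i. odd (z $ i)} \<in> rm_code"
  proof -
    have "(\<forall>k<16. odd (z $ of_nat k) = rm_bit p k) \<longleftrightarrow> {i. odd (z $ i)} = rm_word p" for p
      using of_nat_mem_rm_word[of _ p] set_16_eqI[of "{i. odd (z $ i)}" "rm_word p"] by auto
    then show ?thesis unfolding rm_code_def by blast
  qed
  finally show ?thesis .
qed

section \<open>The minimal vectors of the Barnes--Wall lattice\<close>

definition bw_ints :: "(int^16) set" where
  "bw_ints = {z. mod2_in_reed_muller z \<and> 4 dvd (\<Sum>i\<in>UNIV. z $ i)}"

text \<open>In integer coordinates, before the division by \<open>sqrt 2\<close>, squared norm 4
  becomes 8.\<close>

definition bw_shell :: "(int^16) set" where
  "bw_shell = {z \<in> bw_ints. iprod z z = 8}"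

text \<open>The minimal vectors come in two shapes: two entries of absolute value 2, giving
  \<open>120 * 4 = 480\<close> vectors, and eight entries of absolute value 1 on a word of weight 8
  with evenly many minus signs, giving \<open>30 * 128 = 3840\<close>.\<close>

definition shell_pairs :: "(int^16) set" where
  "shell_pairs = (\<lambda>(c, S). 2 *s signed c S) ` (SIGMA c:{c. card c = 2}. Pow c)"

definition shell_octads :: "(int^16) set" where
  "shell_octads = (\<lambda>(c, S). signed c S) ` (SIGMA c:rm_code8. {S. S \<subseteq> c \<and> even (card S)})"

lemma iprod_signed_self: "iprod (signed c S) (signed c S) = int (card c)"
  by (simp add: iprod_signed)

lemma sum_signed_entries:
  assumes "S \<subseteq> c"
  shows "(\<Sum>i\<in>UNIV. signed c S $ i) = int (card c) - 2 * int (card (S :: 'n::finite set))"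
proof -
  have "(\<Sum>i\<in>UNIV. signed c S $ i) = (\<Sum>i\<in>UNIV. of_bool (i \<in> c) - 2 * of_bool (i \<in> S))"
    using assms unfolding signed_def by (intro sum.cong) auto
  also have "\<dots> = (\<Sum>i\<in>UNIV. of_bool (i \<in> c)) - 2 * (\<Sum>i\<in>UNIV. of_bool (i \<in> S))"
    by (simp only: sum_subtractf sum_distrib_left)
  finally show ?thesis by (simp only: sum_of_bool_eq finite Int_UNIV_left Collect_mem_eq of_nat_id)
qed

lemma eq_signed:
  fixes z :: "int^'n::finite"
  assumes "\<And>i. z $ i * z $ i = of_bool (i \<in> c)"
  shows "z = signed c {i. z $ i < 0}" "{i. z $ i < 0} \<subseteq> c"
proof -
  have 1: "z $ i = 1 \<or> z $ i = -1" if "i \<in> c" for i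
    using assms[of i] that by (simp add: zmult_eq_1_iff)
  have 0: "z $ i = 0" if "i \<notin> c" for i using assms[of i] that by simp
  show "z = signed c {i. z $ i < 0}"
    unfolding vec_eq_iff
  proof
    fix i show "z $ i = signed c {i. z $ i < 0} $ i" using 0[of i] 1[of i] by (auto simp: signed_def)
  qed
  show "{i. z $ i < 0} \<subseteq> c" using 0 by force
qed

lemma even_half_vec:
  fixes z :: "int^'n::finite"
  assumes "{i. odd (z $ i)} = {}"
  obtains w where "z = 2 *s w" "\<And>i. z $ i = 2 * w $ i"
proof
  show "\<And>i. z $ i = 2 * (\<chi> i. z $ i div 2) $ i" using assms by auto
  then show "z = 2 *s (\<chi> i. z $ i div 2)" by (simp add: vec_eq_iff)
qed

lemma sum_eq_imp_eq:
  fixes f g :: "'a \<Rightarrow> int"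
  assumes "finite A" "\<And>i. i \<in> A \<Longrightarrow> f i \<le> g i" "sum f A = sum g A" "i \<in> A"
  shows "f i = g i"
  using sum_mono_inv[of f A g i] assms by auto

lemma nonzero_le_square: "of_bool (x \<noteq> 0) \<le> x * (x :: int)"
  by (cases "x = 0") (auto simp: int_one_le_iff_zero_less zero_less_mult_iff linorder_neq_iff)

lemma odd_le_square: "of_bool (odd x) \<le> x * (x :: int)"
  by (rule order_trans[OF _ nonzero_le_square]) auto

lemma iprod_odd_ge: "int (card {i. odd (z $ i)}) \<le> iprod z z"
proof -
  have "int (card {i. odd (z $ i)}) = (\<Sum>i\<in>UNIV. of_bool (odd (z $ i)))" by (simp add: sum_of_bool_eq)
  also have "\<dots> \<le> iprod z z" unfolding iprod_def by (intro sum_mono odd_le_square)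
  finally show ?thesis .
qed

lemma iprod_nonneg: "iprod z z \<ge> 0"
  unfolding iprod_def by (intro sum_nonneg) auto

lemma iprod_eq_0: "iprod z z = 0 \<Longrightarrow> z = 0"
  unfolding iprod_def by (subst (asm) sum_nonneg_eq_0_iff) (auto simp: vec_eq_iff)

text \<open>If all entries are even, halving leaves an even coordinate sum, hence an even squared
  norm, at least 2, which is multiplied by 4 again. Otherwise the odd entries fill a nonzero
  codeword, so there are at least eight.\<close>

lemma bw_ints_norm_ge:
  assumes "z \<in> bw_ints" "z \<noteq> 0"
  shows "iprod z z \<ge> 8"
proof (cases "{i. odd (z $ i)} = {}")
  case True
  obtain w where w: "z = 2 *s w" "\<And>i. z $ i = 2 * w $ i" using even_half_vec[OF True] by blast
  have "4 dvd (\<Sum>i\<in>UNIV. 2 * w $ i)" using assms w by (simp add: bw_ints_def)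
  then have "even (\<Sum>i\<in>UNIV. w $ i)" by (simp flip: sum_distrib_left) presburger
  moreover have "even (\<Sum>i\<in>UNIV. w $ i * w $ i - w $ i)" by (intro dvd_sum) auto
  ultimately have "even (iprod w w)" by (simp add: iprod_def sum_subtractf)
  moreover have "w \<noteq> 0" using assms w by auto
  ultimately have "iprod w w \<ge> 2" using iprod_nonneg[of w] iprod_eq_0[of w] by (cases "iprod w w = 0 \<or> iprod w w = 1") auto
  then show ?thesis by (simp add: w iprod_scale)
next
  case False
  have "{i. odd (z $ i)} \<in> rm_code" using assms by (simp add: bw_ints_def mod2_in_reed_muller_iff)
  then have "card {i. odd (z $ i)} \<ge> 8"
    using False rm_code_weight[of "{i. odd (z $ i)}"] by (cases "{i. odd (z $ i)} = UNIV") auto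
  then show ?thesis using iprod_odd_ge[of z] by linarith
qed

lemma odd_signed: "{i. odd (signed c S $ i)} = c"
  by (auto simp: signed_def)

text \<open>The case of equality in \<open>bw_ints_norm_ge\<close>: the half vector has squared norm
  2, or the odd entries are exactly eight, all of absolute value 1, and the others vanish.\<close>

lemma bw_shell_eq: "bw_shell = shell_pairs \<union> shell_octads"
proof (intro equalityI subsetI)
  fix z assume "z \<in> bw_shell"
  then have z: "{i. odd (z $ i)} \<in> rm_code" "4 dvd (\<Sum>i\<in>UNIV. z $ i)" "iprod z z = 8"
    by (auto simp: bw_shell_def bw_ints_def mod2_in_reed_muller_iff)
  show "z \<in> shell_pairs \<union> shell_octads"
  proof (cases "{i. odd (z $ i)} = {}")
    case True
    obtain w where w: "z = 2 *s w" using even_half_vec[OF True] by blast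
    have ww: "iprod w w = 2" using z(3) by (simp add: w iprod_scale)
    let ?c = "{i. w $ i \<noteq> 0}"
    have bd: "\<bar>w $ i\<bar> \<le> 1" for i
    proof (rule ccontr)
      assume "\<not> \<bar>w $ i\<bar> \<le> 1"
      then have "2 * 2 \<le> \<bar>w $ i\<bar> * \<bar>w $ i\<bar>" by (intro mult_mono) auto
      then have "4 \<le> w $ i * w $ i" by simp
      moreover have "w $ i * w $ i \<le> iprod w w"
        unfolding iprod_def by (rule member_le_sum[of i UNIV "\<lambda>i. w $ i * w $ i"]) auto
      ultimately show False using ww by simp
    qed
    have sq: "w $ i * w $ i = of_bool (i \<in> ?c)" for i
    proof -
      have "w $ i = 0 \<or> w $ i = 1 \<or> w $ i = -1" using bd[of i] by linarith
      then show ?thesis by auto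
    qed
    have "int (card ?c) = 2" using ww by (simp add: iprod_def sq sum_of_bool_eq)
    then have "card ?c = 2" by simp
    then have "z \<in> shell_pairs"
      unfolding shell_pairs_def using eq_signed[OF sq] w by (intro image_eqI[of _ _ "(?c, {i. w $ i < 0})"]) auto
    then show ?thesis by simp
  next
    case False
    let ?c = "{i. odd (z $ i)}"
    have "?c \<noteq> UNIV" using iprod_odd_ge[of z] z by auto
    then have c: "?c \<in> rm_code8" using False z by (simp add: rm_code8_def)
    have "of_bool (odd (z $ i)) = z $ i * z $ i" for i
    proof (rule sum_eq_imp_eq[where A = UNIV and f = "\<lambda>i. of_bool (odd (z $ i))" and g = "\<lambda>i. z $ i * z $ i"])
      show "(\<Sum>i\<in>UNIV. of_bool (odd (z $ i))) = (\<Sum>i\<in>UNIV. z $ i * z $ i)"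
        using z card_mem_rm_code8[OF c] by (simp add: sum_of_bool_eq iprod_def)
    qed (simp, rule odd_le_square, simp)
    then have sq: "z $ i * z $ i = of_bool (i \<in> ?c)" for i by simp
    let ?S = "{i. z $ i < 0}"
    \<comment> \<open>The coordinate sum of a sign vector of weight 8; divisibility by 4 becomes
      evenness of the number of minus signs.\<close>
    have "4 dvd 8 - 2 * int (card ?S)"
      using z(2) sum_signed_entries[OF eq_signed(2)[OF sq]] eq_signed(1)[OF sq] card_mem_rm_code8[OF c] by simp
    then have "even (card ?S)" by presburger
    then have "z \<in> shell_octads"
      unfolding shell_octads_def using eq_signed[OF sq] c by (intro image_eqI[of _ _ "(?c, ?S)"]) auto
    then show ?thesis by simp
  qed
next
  fix z assume "z \<in> shell_pairs \<union> shell_octads"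
  then consider (1) c S where "z = 2 *s signed c S" "card c = 2" "S \<subseteq> c"
    | (2) c S where "z = signed c S" "c \<in> rm_code8" "S \<subseteq> c" "even (card S)"
    by (auto simp: shell_pairs_def shell_octads_def)
  then show "z \<in> bw_shell"
  proof cases
    case 1
    have "{i. odd (z $ i)} = {}" using 1 by simp
    moreover have "(\<Sum>i\<in>UNIV. z $ i) = 2 * (2 - 2 * int (card S))"
      using sum_signed_entries[OF 1(3)] 1 by (simp flip: sum_distrib_left)
    moreover have "iprod z z = 8" using 1 by (simp add: iprod_scale iprod_signed_self)
    ultimately show ?thesis
      using rm_code_trivial(1) by (auto simp: bw_shell_def bw_ints_def mod2_in_reed_muller_iff)
  next
    case 2
    have "{i. odd (z $ i)} \<in> rm_code" using 2 by (simp add: odd_signed rm_code8_def)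
    moreover have "(\<Sum>i\<in>UNIV. z $ i) = 8 - 2 * int (card S)"
      using sum_signed_entries[OF 2(3)] 2 card_mem_rm_code8 by simp
    moreover have "iprod z z = 8" using 2 card_mem_rm_code8 by (simp add: iprod_signed_self)
    moreover have "4 dvd 8 - 2 * int (card S)" using 2(4) by presburger
    ultimately show ?thesis by (simp add: bw_shell_def bw_ints_def mod2_in_reed_muller_iff)
  qed
qed

lemma shell_disjoint: "shell_pairs \<inter> shell_octads = {}"
proof -
  have "{i. odd (z $ i)} = {}" if "z \<in> shell_pairs" for z using that by (auto simp: shell_pairs_def)
  moreover have "{i. odd (z $ i)} \<noteq> {}" if "z \<in> shell_octads" for z
    using that by (auto simp: shell_octads_def odd_signed rm_code8_def simp del: Collect_empty_eq)
  ultimately show ?thesis by blast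
qed

lemma finite_shell: "finite shell_pairs" "finite shell_octads"
  by (simp_all add: shell_pairs_def shell_octads_def)

lemma sum_shell_pairs: "sum F shell_pairs = (\<Sum>c | card c = 2. \<Sum>S\<in>Pow c. F (2 *s signed c S))"
proof -
  have half: "u = v" if "2 *s u = 2 *s v" for u v :: "int^16" using that by (simp add: vec_eq_iff)
  have inj: "inj_on (\<lambda>(c, S). 2 *s signed c S :: int^16) (SIGMA c:{c. card c = 2}. Pow c)"
    by (rule inj_onI) (auto dest!: half dest: signed_inject)
  have "sum F shell_pairs = (\<Sum>(c, S)\<in>(SIGMA c:{c. card c = 2}. Pow c). F (2 *s signed c S))"
    unfolding shell_pairs_def sum.reindex[OF inj] by (simp add: o_def case_prod_unfold)
  also have "\<dots> = (\<Sum>c | card c = 2. \<Sum>S\<in>Pow c. F (2 *s signed c S))"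
    by (rule sum.Sigma[symmetric]) auto
  finally show ?thesis .
qed

lemma sum_shell_octads:
  "sum F shell_octads = (\<Sum>c\<in>rm_code8. \<Sum>S | S \<subseteq> c \<and> even (card S). F (signed c S))"
proof -
  have inj: "inj_on (\<lambda>(c, S). signed c S :: int^16) (SIGMA c:rm_code8. {S. S \<subseteq> c \<and> even (card S)})"
    by (rule inj_onI) (auto dest: signed_inject)
  have "sum F shell_octads = (\<Sum>(c, S)\<in>(SIGMA c:rm_code8. {S. S \<subseteq> c \<and> even (card S)}). F (signed c S))"
    unfolding shell_octads_def sum.reindex[OF inj] by (simp add: o_def case_prod_unfold)
  also have "\<dots> = (\<Sum>c\<in>rm_code8. \<Sum>S | S \<subseteq> c \<and> even (card S). F (signed c S))"
    by (rule sum.Sigma[symmetric]) auto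
  finally show ?thesis .
qed

lemma sum_bw_shell: "sum F bw_shell = sum F shell_pairs + sum F shell_octads"
  unfolding bw_shell_eq by (rule sum.union_disjoint) (auto simp: finite_shell shell_disjoint)

section \<open>Counting inner products over the shell\<close>

lemma card_Diff_Int: "card (c' - c) = card c' - card (c \<inter> (c' :: 'n::finite set))"
  by (simp add: card_Diff_subset_Int Int_commute)

lemma sign_sum_small:
  "sign_sum g m 0 = g 0"
  "sign_sum g m (Suc 0) = g m + g (- m)"
  "sign_sum g m 2 = g (2 * m) + 2 * g 0 + g (- 2 * m)"
  "sign_sum g m 4 = g (4 * m) + 4 * g (2 * m) + 6 * g 0 + 4 * g (- 2 * m) + g (- 4 * m)"
  by (simp_all add: sign_sum_def eval_nat_numeral algebra_simps)

lemma sum_bw_shell_iprod_pair: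
  fixes g :: "int \<Rightarrow> real"
  assumes "card c = 2"
  shows "(\<Sum>w\<in>bw_shell. g (iprod (2 *s signed c S0) w)) =
    g 8 + 280 * (g 4 + g (-4)) + 1024 * (g 2 + g (-2)) + 1710 * g 0 + g (-8)"
proof -
  have "(\<Sum>w\<in>shell_pairs. g (iprod (2 *s signed c S0) w)) =
      (\<Sum>c' | card c' = 2. 2 ^ (2 - card (c \<inter> c')) * sign_sum g 4 (card (c \<inter> c')))"
    using sum_signed[of g 4 c S0] by (auto simp: sum_shell_pairs iprod_scale card_Diff_Int intro!: sum.cong)
  \<comment> \<open>Of the 120 pairs, 1, 28 and 91 meet \<open>c\<close> in 2, 1 and 0
    points.\<close>
  also have "\<dots> = 56 * (g 4 + g (-4)) + 366 * g 0 + g 8 + g (-8)"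
    using assms sum_subsets_card_Int[of "\<lambda>k. 2 ^ (2 - k) * sign_sum g 4 k" c 2]
    by (simp add: Compl_eq_Diff_UNIV card_Diff_subset numeral_2_eq_2 sign_sum_small[unfolded numeral_2_eq_2] choose_two)
  finally have 1: "(\<Sum>w\<in>shell_pairs. g (iprod (2 *s signed c S0) w)) = 56 * (g 4 + g (-4)) + 366 * g 0 + g 8 + g (-8)" .
  have "(\<Sum>S | S \<subseteq> c' \<and> even (card S). g (iprod (2 *s signed c S0) (signed c' S))) =
      2 ^ (7 - card (c \<inter> c')) * sign_sum g 2 (card (c \<inter> c'))" if "c' \<in> rm_code8" for c'
  proof -
    have "\<not> c' \<subseteq> c"
      using card_mono[of c c'] card_mem_rm_code8[OF that] assms by auto
    then show ?thesis
      using sum_signed_even[of c' c g 2 S0] card_mem_rm_code8[OF that]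
      by (simp add: card_Diff_Int iprod_scale)
  qed
  then have "(\<Sum>w\<in>shell_octads. g (iprod (2 *s signed c S0) w)) =
      (\<Sum>c'\<in>rm_code8. 2 ^ (7 - card (c \<inter> c')) * sign_sum g 2 (card (c \<inter> c')))"
    by (simp add: sum_shell_octads)
  also have "\<dots> = 224 * (g 4 + g (-4)) + 1024 * (g 2 + g (-2)) + 1344 * g 0"
    using sum_rm_code8_pair[OF assms, of "\<lambda>k. 2 ^ (7 - k) * sign_sum g 2 k"]
    by (simp add: sign_sum_small)
  finally show ?thesis unfolding sum_bw_shell 1 by simp
qed

lemma sum_bw_shell_iprod_octad:
  fixes g :: "int \<Rightarrow> real"
  assumes c: "c \<in> rm_code8" and S0: "S0 \<subseteq> c" "even (card S0)"
  shows "(\<Sum>w\<in>bw_shell. g (iprod (signed c S0) w)) =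
    g 8 + 280 * (g 4 + g (-4)) + 1024 * (g 2 + g (-2)) + 1710 * g 0 + g (-8)"
proof -
  have c8: "card c = 8" by (rule card_mem_rm_code8[OF c])
  have choose8: "8 choose Suc (Suc 0) = 28" by (simp add: eval_nat_numeral)
  have "(\<Sum>w\<in>shell_pairs. g (iprod (signed c S0) w)) =
      (\<Sum>c' | card c' = 2. 2 ^ (2 - card (c \<inter> c')) * sign_sum g 2 (card (c \<inter> c')))"
    using sum_signed[of g 2 c S0]
    by (auto simp: sum_shell_pairs iprod_scale card_Diff_Int intro!: sum.cong)
  \<comment> \<open>Of the 120 pairs, 28, 64 and 28 meet \<open>c\<close> in 2, 1 and 0
    points.\<close>
  also have "\<dots> = 28 * (g 4 + g (-4)) + 128 * (g 2 + g (-2)) + 168 * g 0"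
    using sum_subsets_card_Int[of "\<lambda>k. 2 ^ (2 - k) * sign_sum g 2 k" c 2]
    by (simp add: c8 choose8 Compl_eq_Diff_UNIV card_Diff_subset numeral_2_eq_2 sign_sum_small[unfolded numeral_2_eq_2] choose_two)
  finally have 1: "(\<Sum>w\<in>shell_pairs. g (iprod (signed c S0) w)) =
      28 * (g 4 + g (-4)) + 128 * (g 2 + g (-2)) + 168 * g 0" .
  define F where "F c' = (\<Sum>S | S \<subseteq> c' \<and> even (card S). g (iprod (signed c S0) (signed c' S)))" for c'
  have F: "F c' = 2 ^ (7 - card (c \<inter> c')) * sign_sum g 1 (card (c \<inter> c'))"
    if "c' \<in> rm_code8" "\<not> c' \<subseteq> c" for c'
    using sum_signed_even[OF that(2), of g 1 S0] card_mem_rm_code8[OF that(1)]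
    by (simp add: card_Diff_Int F_def)
  have "(\<Sum>w\<in>shell_octads. g (iprod (signed c S0) w)) = (\<Sum>c'\<in>rm_code8. F c')"
    by (simp add: sum_shell_octads F_def)
  also have "\<dots> = F c + F (- c) + 28 * (8 * sign_sum g 1 4)"
  proof (rule sum_rm_code8[OF c])
    fix c' assume c': "c' \<in> rm_code8" "card (c \<inter> c') = 4"
    then have "c \<inter> c' \<noteq> c'" using card_mem_rm_code8[OF c'(1)] by auto
    then have "\<not> c' \<subseteq> c" by auto
    then show "F c' = 8 * sign_sum g 1 4" using F c' by simp
  qed
  also have "F (- c) = 128 * g 0"
    using F[OF Compl_mem_rm_code8[OF c]] c8 Compl_mem_rm_code8[OF c] by (force simp: sign_sum_small rm_code8_def)
  also have "F c = g 8 + 28 * g 4 + 70 * g 0 + 28 * g (-4) + g (-8)"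
  proof -
    have "{..8::nat} = {0, 1, 2, 3, 4, 5, 6, 7, 8}" by auto
    moreover have "(8 choose 4 :: nat) = 70" "(8 choose 6 :: nat) = 28" "(8 choose 2 :: nat) = 28"
      by (simp_all add: eval_nat_numeral)
    ultimately show ?thesis unfolding F_def sum_signed_even_self[OF S0] c8 by simp
  qed
  finally show ?thesis unfolding sum_bw_shell 1 by (simp add: sign_sum_small)
qed

text \<open>With \<open>g\<close> arbitrary, one equation carries the whole distance distribution:
  the coefficient of \<open>g n\<close> counts the vectors with inner product \<open>n\<close>. Both
  shapes of \<open>z\<close> give the same right-hand side.\<close>

lemma sum_bw_shell_iprod:
  fixes g :: "int \<Rightarrow> real"
  assumes "z \<in> bw_shell"
  shows "(\<Sum>w\<in>bw_shell. g (iprod z w)) =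
    g 8 + 280 * (g 4 + g (-4)) + 1024 * (g 2 + g (-2)) + 1710 * g 0 + g (-8)"
  using assms sum_bw_shell_iprod_pair sum_bw_shell_iprod_octad
  by (fastforce simp: bw_shell_eq shell_pairs_def shell_octads_def)

section \<open>The kissing configuration\<close>

lemma bw_shell_nonempty: "bw_shell \<noteq> {}"
proof -
  have "2 *s signed {0, 1} {} \<in> shell_pairs"
    unfolding shell_pairs_def by (intro image_eqI[of _ _ "({0, 1}, {})"]) auto
  then show ?thesis by (auto simp: bw_shell_eq)
qed

lemma finite_bw_shell: "finite bw_shell"
  by (simp add: bw_shell_eq finite_shell)

lemma card_bw_shell: "card bw_shell = 4320"
proof -
  obtain z where "z \<in> bw_shell" using bw_shell_nonempty by auto
  from sum_bw_shell_iprod[OF this, of "\<lambda>_. 1"] show ?thesis by simp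
qed

definition bw_embed :: "int^16 \<Rightarrow> real^16" where
  "bw_embed z = (\<chi> i. real_of_int (z $ i) / sqrt 2)"

lemma inner_bw_embed: "bw_embed z \<bullet> bw_embed w = real_of_int (iprod z w) / 2"
  by (simp add: bw_embed_def inner_vec_def iprod_def sum_divide_distrib)

lemma norm_bw_embed: "norm (bw_embed z) = sqrt (real_of_int (iprod z z) / 2)"
  by (simp add: norm_eq_sqrt_inner inner_bw_embed)

lemma inj_bw_embed: "inj bw_embed"
  by (rule injI) (simp add: bw_embed_def vec_eq_iff)

lemma bw_embed_eq_0_iff: "bw_embed z = 0 \<longleftrightarrow> z = 0"
  by (simp add: bw_embed_def vec_eq_iff)

lemma barnes_wall_lattice_eq: "barnes_wall_lattice = bw_embed ` bw_ints"
  by (auto simp: barnes_wall_lattice_def bw_ints_def bw_embed_def)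

lemma minimal_vectors_barnes_wall: "minimal_vectors barnes_wall_lattice = bw_embed ` bw_shell"
proof (intro equalityI subsetI)
  fix x assume x: "x \<in> minimal_vectors barnes_wall_lattice"
  then obtain z where z: "x = bw_embed z" "z \<in> bw_ints" "z \<noteq> 0"
    by (auto simp: minimal_vectors_def barnes_wall_lattice_eq bw_embed_eq_0_iff)
  obtain w where w: "w \<in> bw_shell" using bw_shell_nonempty by auto
  then have "w \<noteq> 0" by (auto simp: bw_shell_def iprod_def)
  then have "norm x \<le> norm (bw_embed w)"
    using x w by (auto simp: minimal_vectors_def barnes_wall_lattice_eq bw_embed_eq_0_iff bw_shell_def)
  then have "iprod z z \<le> 8" using w z by (simp add: norm_bw_embed bw_shell_def)
  then have "z \<in> bw_shell" using bw_ints_norm_ge[OF z(2,3)] z by (simp add: bw_shell_def)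
  then show "x \<in> bw_embed ` bw_shell" using z by auto
next
  fix x assume "x \<in> bw_embed ` bw_shell"
  then obtain z where z: "x = bw_embed z" "z \<in> bw_ints" "iprod z z = 8" by (auto simp: bw_shell_def)
  then have "z \<noteq> 0" by (auto simp: iprod_def)
  then have "x \<in> barnes_wall_lattice - {0}" using z by (simp add: barnes_wall_lattice_eq bw_embed_eq_0_iff)
  moreover have "norm x \<le> norm y" if y: "y \<in> barnes_wall_lattice - {0}" for y
  proof -
    obtain w where w: "y = bw_embed w" "w \<in> bw_ints"
      using y unfolding barnes_wall_lattice_eq by blast
    have "w \<noteq> 0" using y w bw_embed_eq_0_iff[of w] by simp
    then show ?thesis
      unfolding z(1) w(1) norm_bw_embed real_sqrt_le_iff using bw_ints_norm_ge[OF w(2)] z(3) by simp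
  qed
  ultimately show "x \<in> minimal_vectors barnes_wall_lattice" by (simp add: minimal_vectors_def)
qed

definition bw_point :: "int^16 \<Rightarrow> real^16" where
  "bw_point z = bw_embed z /\<^sub>R 2"

lemma inner_bw_point: "bw_point z \<bullet> bw_point w = real_of_int (iprod z w) / 8"
  by (simp add: bw_point_def inner_bw_embed)

lemma inj_bw_point: "inj bw_point"
  using inj_bw_embed by (auto simp: bw_point_def inj_def)

abbreviation (input) barnes_wall_kissing :: "(real^16) set" where
  "barnes_wall_kissing \<equiv> kissing_configuration barnes_wall_lattice"

lemma kissing_eq: "barnes_wall_kissing = bw_point ` bw_shell"
proof -
  have "norm (bw_embed z) = 2" if "z \<in> bw_shell" for z
    using that by (simp add: norm_bw_embed bw_shell_def)
  then show ?thesis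
    by (simp add: kissing_configuration_def minimal_vectors_barnes_wall image_image bw_point_def cong: image_cong)
qed

lemma kissing_code: "spherical_code barnes_wall_kissing"
proof -
  have "norm (bw_point z) = 1" if "z \<in> bw_shell" for z
    using that by (simp add: norm_eq_1 inner_bw_point bw_shell_def)
  then show ?thesis by (auto simp: spherical_code_def kissing_eq finite_bw_shell)
qed

lemma card_kissing: "card barnes_wall_kissing = 4320"
  unfolding kissing_eq using inj_bw_point by (simp add: card_image inj_on_subset card_bw_shell)

lemma sum_kissing_inner:
  fixes g :: "real \<Rightarrow> real"
  assumes "x \<in> barnes_wall_kissing"
  shows "(\<Sum>y\<in>barnes_wall_kissing. g (x \<bullet> y)) = g 1 + bw_dist_sum g"
proof -
  obtain z where z: "x = bw_point z" "z \<in> bw_shell" using assms by (auto simp: kissing_eq)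
  have "(\<Sum>y\<in>barnes_wall_kissing. g (x \<bullet> y)) = (\<Sum>w\<in>bw_shell. g (real_of_int (iprod z w) / 8))"
    unfolding kissing_eq using inj_bw_point by (simp add: sum.reindex inj_on_subset z inner_bw_point)
  also have "\<dots> = g 1 + bw_dist_sum g"
    unfolding sum_bw_shell_iprod[OF z(2), of "\<lambda>n. g (real_of_int n / 8)"] bw_dist_sum_def by simp
  finally show ?thesis .
qed

lemma inner_products_kissing: "inner_products barnes_wall_kissing \<subseteq> {-1, -1/2, -1/4, 0, 1/4, 1/2}"
proof
  fix t assume "t \<in> inner_products barnes_wall_kissing"
  then obtain x y where xy: "t = x \<bullet> y" "x \<in> barnes_wall_kissing" "y \<in> barnes_wall_kissing" "x \<noteq> y"
    by (auto simp: inner_products_def)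
  let ?V = "{-1, -1/2, -1/4, 0, 1/4, 1/2, 1} :: real set"
  \<comment> \<open>The indicator of all other values: its sum over the code is zero, so none of
    them occurs.\<close>
  define g :: "real \<Rightarrow> real" where "g u = of_bool (u \<notin> ?V)" for u
  have "(\<Sum>y\<in>barnes_wall_kissing. g (x \<bullet> y)) = 0"
    unfolding sum_kissing_inner[OF xy(2)] bw_dist_sum_def by (simp add: g_def)
  then have "g (x \<bullet> y) = 0"
    using xy kissing_code by (subst (asm) sum_nonneg_eq_0_iff) (auto simp: g_def spherical_code_def)
  then have "t \<in> ?V" using xy by (simp add: g_def)
  moreover have "t < 1"
  proof -
    have "norm x = 1" "norm y = 1" using xy kissing_code by (auto simp: spherical_code_def)
    then show ?thesis using inner_unit_bounds[of x y] xy by simp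
  qed
  ultimately show "t \<in> {-1, -1/2, -1/4, 0, 1/4, 1/2}" by auto
qed

lemma energy_kissing: "energy h barnes_wall_kissing = 4320 * bw_dist_sum h"
proof -
  have fin: "finite barnes_wall_kissing" and sph: "barnes_wall_kissing \<subseteq> sphere 0 1"
    using kissing_code by (auto simp: spherical_code_def)
  have "(\<Sum>y\<in>barnes_wall_kissing - {x}. h (x \<bullet> y)) = bw_dist_sum h" if x: "x \<in> barnes_wall_kissing" for x
  proof -
    have "x \<bullet> x = 1" using x sph by (auto simp: norm_eq_1)
    then show ?thesis using sum_kissing_inner[OF x, of h] x fin by (simp add: sum.remove)
  qed
  then show ?thesis by (simp add: energy_eq_sum[OF fin] card_kissing)
qed

lemma kissing_admissible:
  assumes "T \<in> bw_avoided_sets"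
  shows "barnes_wall_kissing \<in> admissible_codes 4320 T"
proof -
  have "t \<notin> T" if "t \<in> {-1, -1/2, -1/4, 0, 1/4, 1/2}" for t
    using assms that unfolding bw_avoided_sets_def by auto
  then show ?thesis
    using inner_products_kissing kissing_code card_kissing by (auto simp: admissible_codes_def avoiding_def)
qed

lemma energy_distance_distribution:
  fixes C :: "(real^'n) set"
  assumes C: "spherical_code C" and V: "inner_products C = {-1, -1/2, -1/4, 0, 1/4, 1/2}"
    and dist: "has_distance_distribution C [1, 280, 1024, 1710, 1024, 280]"
  shows "energy h C = real (card C) * bw_dist_sum h"
proof -
  have fin: "finite C" and sph: "C \<subseteq> sphere 0 1" using C by (auto simp: spherical_code_def)
  have sorted: "sorted_list_of_set (inner_products C) = bw_nodes"
  proof -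
    have "inner_products C = set bw_nodes" "sorted bw_nodes" "distinct bw_nodes" by (simp_all add: V bw_nodes_def)
    then show ?thesis by (simp add: sorted_list_of_set.idem_if_sorted_distinct)
  qed
  have "(\<Sum>y\<in>C - {x}. h (x \<bullet> y)) = bw_dist_sum h" if x: "x \<in> C" for x
  proof -
    have count: "map (\<lambda>t. card {y \<in> C. x \<bullet> y = t}) bw_nodes = [1, 280, 1024, 1710, 1024, 280]"
      using dist x unfolding has_distance_distribution_def sorted by blast
    have xx: "x \<bullet> x = 1" using x sph by (auto simp: norm_eq_1)
    have "(\<Sum>y\<in>C - {x}. h (x \<bullet> y)) = (\<Sum>t\<in>inner_products C. \<Sum>y | y \<in> C - {x} \<and> x \<bullet> y = t. h (x \<bullet> y))"
      using fin x by (intro sum.group[symmetric]) (auto simp: V[symmetric], simp add: V, auto simp: inner_products_def)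
    also have "\<dots> = (\<Sum>t\<in>inner_products C. real (card {y \<in> C. x \<bullet> y = t}) * h t)"
    proof (rule sum.cong[OF refl])
      fix t assume "t \<in> inner_products C"
      \<comment> \<open>Dropping \<open>x\<close> changes nothing, because 1 is not among the inner
        products.\<close>
      then have "{y. y \<in> C - {x} \<and> x \<bullet> y = t} = {y \<in> C. x \<bullet> y = t}" using xx by (auto simp: V)
      then show "(\<Sum>y | y \<in> C - {x} \<and> x \<bullet> y = t. h (x \<bullet> y)) = real (card {y \<in> C. x \<bullet> y = t}) * h t" by simp
    qed
    also have "\<dots> = bw_dist_sum h"
      using count unfolding V by (simp add: bw_nodes_def bw_dist_sum_def)
    finally show ?thesis .
  qed
  then show ?thesis by (simp add: energy_eq_sum[OF fin])
qed

section \<open>Attainment of the minimum energy\<close>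

lemma min_energy_eq:
  assumes T: "T \<in> bw_avoided_sets" and am: "absolutely_monotone h"
  shows "min_energy TYPE(16) h 4320 T = 4320 * bw_dist_sum h"
  unfolding min_energy_def
proof (rule Least_equality)
  show "4320 * bw_dist_sum h \<in> energy h ` (admissible_codes 4320 T :: (real^16) set set)"
    by (intro image_eqI[of _ _ barnes_wall_kissing] energy_kissing[symmetric] kissing_admissible[OF T])
  fix e assume "e \<in> energy h ` (admissible_codes 4320 T :: (real^16) set set)"
  then show "4320 * bw_dist_sum h \<le> e" using energy_lower_bound[OF T am] by blast
qed

theorem theorem7p10:
  fixes T :: "real set"
  assumes "T \<in> {{-1/2<..<-1/4} \<union> {1/4<..<1/2},
                {-1/4<..<0} \<union> {1/4<..<1/2},
                {-1/2<..<-1/4} \<union> {0<..<1/4}}"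
  shows "(\<forall>h :: real \<Rightarrow> real.
            absolutely_monotone h \<and> (\<forall>t \<in> {-1<..<1}. (deriv ^^ 8) h t > 0) \<longrightarrow>
              min_energy TYPE(16) h 4320 T \<in> energy h ` (admissible_codes 4320 T :: (real^16) set set) \<and>
              min_energy TYPE(16) h 4320 T =
                4320 * (280 * (h (-1/2) + h (1/2)) + 1024 * (h (-1/4) + h (1/4))
                        + 1710 * h 0 + h (-1)) \<and>
              (\<forall>C :: (real^16) set.
                 spherical_code C \<and> avoiding T C \<and> card C = 4320 \<longrightarrow>
                   energy h C \<ge> min_energy TYPE(16) h 4320 T \<and>
                   (spherical_design 7 C \<and>
                    inner_products C = {-1, -1/2, -1/4, 0, 1/4, 1/2} \<longrightarrow>
                      distance_invariant C \<and>
                      (has_distance_distribution C [1, 280, 1024, 1710, 1024, 280] \<longrightarrow>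
                         energy h C = min_energy TYPE(16) h 4320 T))))
         \<and> avoiding_universally_optimal T (kissing_configuration barnes_wall_lattice)"
proof -
  have T: "T \<in> bw_avoided_sets" using assms by (simp only: bw_avoided_sets_def)
  note adm = kissing_admissible[OF T]
  show ?thesis
  proof (intro conjI allI impI)
    fix h assume h: "absolutely_monotone h \<and> (\<forall>t \<in> {-1<..<1}. (deriv ^^ 8) h t > 0)"
    then have min: "min_energy TYPE(16) h 4320 T = 4320 * bw_dist_sum h" using min_energy_eq[OF T] by blast
    show "min_energy TYPE(16) h 4320 T \<in> energy h ` (admissible_codes 4320 T :: (real^16) set set)"
      unfolding min by (intro image_eqI[of _ _ barnes_wall_kissing] energy_kissing[symmetric] adm)
    show "min_energy TYPE(16) h 4320 T =
        4320 * (280 * (h (-1/2) + h (1/2)) + 1024 * (h (-1/4) + h (1/4)) + 1710 * h 0 + h (-1))"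
      unfolding min bw_dist_sum_def ..
    fix C :: "(real^16) set"
    assume C: "spherical_code C \<and> avoiding T C \<and> card C = 4320"
    then have "C \<in> admissible_codes 4320 T" by (simp add: admissible_codes_def)
    then show "energy h C \<ge> min_energy TYPE(16) h 4320 T"
      unfolding min using energy_lower_bound[OF T] h by blast
    assume D: "spherical_design 7 C \<and> inner_products C = {-1, -1/2, -1/4, 0, 1/4, 1/2}"
    have "card (inner_products C) \<le> Suc 7"
      using D card_length[of "[-1, -1/2, -1/4, 0, 1/4, 1/2 :: real]"] by simp
    then show "distance_invariant C" using D spherical_design_distance_invariant by blast
    assume "has_distance_distribution C [1, 280, 1024, 1710, 1024, 280]"
    then show "energy h C = min_energy TYPE(16) h 4320 T"
      unfolding min using energy_distance_distribution[of C h] C D by simp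
  next
    show "avoiding_universally_optimal T (kissing_configuration barnes_wall_lattice)"
      unfolding avoiding_universally_optimal_def card_kissing energy_kissing
    proof (intro conjI allI impI)
      show "spherical_code barnes_wall_kissing" "avoiding T barnes_wall_kissing"
        using adm by (simp_all add: admissible_codes_def)
    qed (rule energy_lower_bound[OF T])
  qed
qed

end
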